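(* Let $(G,<,\mathbf{q})$ be a stable assignment instance, let $X\in\{A,B\}$ and let $Y$ be the other side. Algorithm $X$-rotate-remove (described below), for any choice made between cases (i) and (ii) at each iteration, terminates and outputs the $Y$-optimal legal assignment; i.e., for $Y=A$ it outputs the legal assignment $M^*$ with $M^*\succeq M$ for every legal $M$, and for $Y=B$ the legal assignment $M^*$ with $M\succeq M^*$ for every legal $M$.
   Context: Setting: $G=(A\cup B,E)$ finite simple bipartite graph (students $A$, schools $B$); $<_v$ a strict total order on the neighbours of each vertex $v$ (write $y>_x y'$, $y\ge_x y'$, and $y>_x\emptyset$ for each neighbour $y$); positive integer quotas $q_b$ for $b\in B$ and $q_a=1$ for $a\in A$. An assignment is $M\subseteq E$ with each vertex $v$ in at most $q_v$ edges; $M(x)=\{y:xy\in M\}$ (for a student, identified with its element or $\emptyset$). Edge $ab$ blocks $M$ if $b>_a M(a)$ and either $|M(b)|<q_b$ or $a>_b a'$ for some $a'\in M(b)$; an assignment blocks $M$ if one of its edges does; $M$ is stable if no edge of the graph blocks it. A set $\mathcal{L}$ of assignments has the legal property if the assignments blocked by some member of $\mathcal{L}$ are exactly those not in $\mathcal{L}$; there is exactly one such set, the legal assignments. $M\succeq M'$ means $M(a)\ge_a M'(a)$ for all $a\in A$. The student-optimal (resp. school-optimal) stable assignment is the stable $M$ with $M\succeq M'$ (resp. $M'\succeq M$) for all stable $M'$. For a subgraph $G'$, $(G',<,\mathbf{q})$ has preferences restricted to $G'$. Rotations: for stable $M$ in an instance and $x\in X$, $s_M(x)$ is the most preferred agent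 $y$ in $x$'s list (in that instance) with $y\notin M(x)$ and $x>_y x'$ for some $x'\in M(y)$ (may not exist); if it exists and $|M(y)|=q_y$, $next_M(x)$ is the $<_y$-least element of $M(y)$, and if $|M(y)|<q_y$, $next_M(x)=\emptyset$. The $X$-rotation digraph of $M$ has vertices $X\cup Y\cup\{\emptyset\}$ and arcs $(x,s_M(x)),(s_M(x),next_M(x))$ for each $x\in X$ with $s_M(x)$ defined. A directed cycle of it corresponds to an $X$-rotation $\rho=y_0,x_0,y_1,x_1,\dots,y_{r-1},x_{r-1}$ with $x_iy_i\in M$, $s_M(x_i)=y_{i+1}$ (indices mod $r$); $M/\rho$ is obtained from $M$ by replacing each $x_iy_i$ with $x_iy_{i+1}$. Algorithm $X$-rotate-remove: let $M^0$ be the $Y$-optimal stable assignment of $(G,<,\mathbf{q})$, $G^0=G$, $i=0$, $D^0$ the $X$-rotation digraph of $M^0$ in $(G^0,<,\mathbf{q})$. While $D^i$ has an arc: find either (i) arcs $(x',y),(y,x)$ of $D^i$ with $x$ a sink of $D^i$, or (ii) a directed cycle of $D^i$ (if both exist, either may be chosen). In case (i), $G^{i+1}$ is $G^i$ with edge $x'y$ removed and $M^{i+1}=M^i$; in case (ii), with $\rho^i$ the corresponding $X$-rotation, $M^{i+1}=M^i/\rho^i$ and $G^{i+1}=G^i$. Set $i:=i+1$ and let $D^i$ be the $X$-rotation digraph of $M^i$ in $(G^i,<,\mathbf{q})$. When $D^i$ has no arc, output $M^i$. *)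

theory Defs
  imports "Graph_Theory.Pair_Digraph" "Graph_Theory.Arc_Walk"
begin

text \<open>Edges are two-element sets \<open>{a, b}\<close>. For each vertex \<open>v\<close>, the relation \<open>pref_less I v\<close> is
  \<open><\<^sub>v\<close>: \<open>(y', y) \<in> pref_less I v\<close> means that \<open>v\<close> strictly prefers \<open>y\<close> to \<open>y'\<close>.\<close>

record 'v sa_instance =
  students :: "'v set"
  schools :: "'v set"
  edges :: "'v set set"
  pref_less :: "'v \<Rightarrow> 'v rel"
  quota :: "'v \<Rightarrow> nat"

definition mates :: "'v set set \<Rightarrow> 'v \<Rightarrow> 'v set" where
  "mates M v = {w. {v, w} \<in> M}"

definition stable_assignment_instance :: "'v sa_instance \<Rightarrow> bool" where
  "stable_assignment_instance I \<longleftrightarrow>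
     finite (students I) \<and> finite (schools I) \<and> students I \<inter> schools I = {} \<and>
     edges I \<subseteq> {{a, b} |a b. a \<in> students I \<and> b \<in> schools I} \<and>
     (\<forall>v \<in> students I \<union> schools I.
        pref_less I v \<subseteq> mates (edges I) v \<times> mates (edges I) v \<and>
        strict_linear_order_on (mates (edges I) v) (pref_less I v)) \<and>
     (\<forall>a \<in> students I. quota I a = 1) \<and>
     (\<forall>b \<in> schools I. quota I b > 0)"

definition restrict_edges :: "'v sa_instance \<Rightarrow> 'v set set \<Rightarrow> 'v sa_instance" where
  "restrict_edges I F =
     I\<lparr>edges := F, pref_less := (\<lambda>v. pref_less I v \<inter> (mates F v \<times> mates F v))\<rparr>"

definition assignment :: "'v sa_instance \<Rightarrow> 'v set set \<Rightarrow> bool" where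
  "assignment I M \<longleftrightarrow> M \<subseteq> edges I \<and>
     (\<forall>v \<in> students I \<union> schools I. card {e \<in> M. v \<in> e} \<le> quota I v)"

text \<open>The empty agent \<open>\<emptyset>\<close> is \<open>None\<close>, both as the partner of an unassigned student and as a
  vertex of the rotation digraph.\<close>

definition partner :: "'v set set \<Rightarrow> 'v \<Rightarrow> 'v option" where
  "partner M a = (if mates M a = {} then None else Some (the_elem (mates M a)))"

fun prefers :: "'v sa_instance \<Rightarrow> 'v \<Rightarrow> 'v option \<Rightarrow> 'v option \<Rightarrow> bool" where
  "prefers I v (Some y) (Some y') \<longleftrightarrow> (y', y) \<in> pref_less I v"
| "prefers I v (Some y) None \<longleftrightarrow> y \<in> mates (edges I) v"
| "prefers I v None _ \<longleftrightarrow> False"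

definition prefers_eq :: "'v sa_instance \<Rightarrow> 'v \<Rightarrow> 'v option \<Rightarrow> 'v option \<Rightarrow> bool" where
  "prefers_eq I v y y' \<longleftrightarrow> y = y' \<or> prefers I v y y'"

definition dominates :: "'v sa_instance \<Rightarrow> 'v set set \<Rightarrow> 'v set set \<Rightarrow> bool" where
  "dominates I M M' \<longleftrightarrow> (\<forall>a \<in> students I. prefers_eq I a (partner M a) (partner M' a))"

definition edge_blocks :: "'v sa_instance \<Rightarrow> 'v \<Rightarrow> 'v \<Rightarrow> 'v set set \<Rightarrow> bool" where
  "edge_blocks I a b M \<longleftrightarrow>
     a \<in> students I \<and> b \<in> schools I \<and> {a, b} \<in> edges I \<and>
     prefers I a (Some b) (partner M a) \<and>
     (card (mates M b) < quota I b \<or> (\<exists>a' \<in> mates M b. (a', a) \<in> pref_less I b))"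

definition blocks :: "'v sa_instance \<Rightarrow> 'v set set \<Rightarrow> 'v set set \<Rightarrow> bool" where
  "blocks I M' M \<longleftrightarrow> (\<exists>a b. {a, b} \<in> M' \<and> edge_blocks I a b M)"

definition stable :: "'v sa_instance \<Rightarrow> 'v set set \<Rightarrow> bool" where
  "stable I M \<longleftrightarrow> assignment I M \<and> \<not> (\<exists>a b. edge_blocks I a b M)"

definition legal_property :: "'v sa_instance \<Rightarrow> 'v set set set \<Rightarrow> bool" where
  "legal_property I L \<longleftrightarrow> L \<subseteq> {M. assignment I M} \<and>
     {M. assignment I M \<and> (\<exists>M' \<in> L. blocks I M' M)} = {M. assignment I M} - L"

definition legal_assignments :: "'v sa_instance \<Rightarrow> 'v set set set" where
  "legal_assignments I = (THE L. legal_property I L)"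

datatype side = Students | Schools

fun opposite :: "side \<Rightarrow> side" where
  "opposite Students = Schools"
| "opposite Schools = Students"

fun agents :: "'v sa_instance \<Rightarrow> side \<Rightarrow> 'v set" where
  "agents I Students = students I"
| "agents I Schools = schools I"

text \<open>Optimality for the schools is, by definition, pessimality for the students.\<close>

fun optimal_in :: "'v sa_instance \<Rightarrow> side \<Rightarrow> 'v set set set \<Rightarrow> 'v set set \<Rightarrow> bool" where
  "optimal_in I Students S M \<longleftrightarrow> M \<in> S \<and> (\<forall>M' \<in> S. dominates I M M')"
| "optimal_in I Schools S M \<longleftrightarrow> M \<in> S \<and> (\<forall>M' \<in> S. dominates I M' M)"

definition optimal_stable :: "'v sa_instance \<Rightarrow> side \<Rightarrow> 'v set set" where
  "optimal_stable I Y = (THE M. optimal_in I Y {M. stable I M} M)"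

definition succ_candidates :: "'v sa_instance \<Rightarrow> 'v set set \<Rightarrow> 'v \<Rightarrow> 'v set" where
  "succ_candidates I M x =
     {y \<in> mates (edges I) x. y \<notin> mates M x \<and> (\<exists>x' \<in> mates M y. (x', x) \<in> pref_less I y)}"

text \<open>\<open>rot_succ I M x\<close> is \<open>s\<^sub>M(x)\<close>, with \<open>None\<close> if it does not exist; \<open>rot_next I M x\<close> is
  \<open>next\<^sub>M(x)\<close>, with \<open>None\<close> for \<open>\<emptyset>\<close> (it is only used where \<open>s\<^sub>M(x)\<close> exists).\<close>

definition rot_succ :: "'v sa_instance \<Rightarrow> 'v set set \<Rightarrow> 'v \<Rightarrow> 'v option" where
  "rot_succ I M x =
     (if succ_candidates I M x = {} then None
      else Some (THE y. y \<in> succ_candidates I M x \<and>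
                        (\<forall>y' \<in> succ_candidates I M x. y' = y \<or> (y', y) \<in> pref_less I x)))"

definition rot_next :: "'v sa_instance \<Rightarrow> 'v set set \<Rightarrow> 'v \<Rightarrow> 'v option" where
  "rot_next I M x = (case rot_succ I M x of
       None \<Rightarrow> None
     | Some y \<Rightarrow>
         if card (mates M y) = quota I y
         then Some (THE z. z \<in> mates M y \<and> (\<forall>z' \<in> mates M y. z' = z \<or> (z, z') \<in> pref_less I y))
         else None)"

definition rotation_digraph ::
    "'v sa_instance \<Rightarrow> side \<Rightarrow> 'v set set \<Rightarrow> 'v option pair_pre_digraph" where
  "rotation_digraph I X M =
     \<lparr>pverts = Some ` (students I \<union> schools I) \<union> {None},
      parcs = {(Some x, Some y) |x y. x \<in> agents I X \<and> rot_succ I M x = Some y} \<union>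
              {(Some y, rot_next I M x) |x y. x \<in> agents I X \<and> rot_succ I M x = Some y}\<rparr>"

definition is_sink :: "'a pair_pre_digraph \<Rightarrow> 'a \<Rightarrow> bool" where
  "is_sink D v \<longleftrightarrow> v \<in> pverts D \<and> out_arcs (with_proj D) v = {}"

text \<open>A rotation \<open>y\<^sub>0, x\<^sub>0, \<dots>, y\<^sub>r\<^sub>-\<^sub>1, x\<^sub>r\<^sub>-\<^sub>1\<close> is the list of its pairs \<open>(y\<^sub>i, x\<^sub>i)\<close>. The corresponding
  cycle is the arc list \<open>(y\<^sub>0, x\<^sub>0), (x\<^sub>0, y\<^sub>1), (y\<^sub>1, x\<^sub>1), \<dots>, (x\<^sub>r\<^sub>-\<^sub>1, y\<^sub>0)\<close>. The arcs of the rotation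
  digraph already guarantee \<open>x\<^sub>iy\<^sub>i \<in> M\<close> and \<open>s\<^sub>M(x\<^sub>i) = y\<^sub>i\<^sub>+\<^sub>1\<close>.\<close>

definition rotation_arcs :: "('v \<times> 'v) list \<Rightarrow> ('v option \<times> 'v option) list" where
  "rotation_arcs \<rho> = concat (map (\<lambda>i.
     [(Some (fst (\<rho> ! i)), Some (snd (\<rho> ! i))),
      (Some (snd (\<rho> ! i)), Some (fst (\<rho> ! (Suc i mod length \<rho>))))]) [0..<length \<rho>])"

definition is_rotation :: "'v sa_instance \<Rightarrow> side \<Rightarrow> 'v set set \<Rightarrow> ('v \<times> 'v) list \<Rightarrow> bool" where
  "is_rotation I X M \<rho> \<longleftrightarrow>
     set \<rho> \<subseteq> agents I (opposite X) \<times> agents I X \<and>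
     pre_digraph.cycle (with_proj (rotation_digraph I X M)) (rotation_arcs \<rho>)"

definition eliminate :: "'v set set \<Rightarrow> ('v \<times> 'v) list \<Rightarrow> 'v set set" where
  "eliminate M \<rho> =
     (M - {{snd (\<rho> ! i), fst (\<rho> ! i)} |i. i < length \<rho>}) \<union>
     {{snd (\<rho> ! i), fst (\<rho> ! (Suc i mod length \<rho>))} |i. i < length \<rho>}"

text \<open>A state of the algorithm is the pair of the current assignment and the edge set of the
  current subgraph.\<close>

type_synonym 'v rr_state = "'v set set \<times> 'v set set"

definition rr_digraph ::
    "'v sa_instance \<Rightarrow> side \<Rightarrow> 'v rr_state \<Rightarrow> 'v option pair_pre_digraph" where
  "rr_digraph I X \<sigma> = rotation_digraph (restrict_edges I (snd \<sigma>)) X (fst \<sigma>)"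

definition rr_init :: "'v sa_instance \<Rightarrow> side \<Rightarrow> 'v rr_state" where
  "rr_init I X = (optimal_stable I (opposite X), edges I)"

inductive rr_step :: "'v sa_instance \<Rightarrow> side \<Rightarrow> 'v rr_state \<Rightarrow> 'v rr_state \<Rightarrow> bool"
  for I :: "'v sa_instance" and X :: side where
  remove: "rr_step I X (M, F) (M, F - {{x', y}})"
    if "x' \<in> agents I X"
      and "(Some x', Some y) \<in> parcs (rr_digraph I X (M, F))"
      and "(Some y, x) \<in> parcs (rr_digraph I X (M, F))"
      and "is_sink (rr_digraph I X (M, F)) x"
| rotate: "rr_step I X (M, F) (eliminate M \<rho>, F)"
    if "is_rotation (restrict_edges I F) X M \<rho>"

definition rr_reachable :: "'v sa_instance \<Rightarrow> side \<Rightarrow> 'v rr_state \<Rightarrow> bool" where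
  "rr_reachable I X \<sigma> \<longleftrightarrow> (rr_step I X)\<^sup>*\<^sup>* (rr_init I X) \<sigma>"

definition rr_halted :: "'v sa_instance \<Rightarrow> side \<Rightarrow> 'v rr_state \<Rightarrow> bool" where
  "rr_halted I X \<sigma> \<longleftrightarrow> parcs (rr_digraph I X \<sigma>) = {}"

text \<open>Every run is finite, and no run gets stuck before the loop condition fails.\<close>

definition rr_terminates :: "'v sa_instance \<Rightarrow> side \<Rightarrow> bool" where
  "rr_terminates I X \<longleftrightarrow>
     (\<nexists>S. S 0 = rr_init I X \<and> (\<forall>i::nat. rr_step I X (S i) (S (Suc i)))) \<and>
     (\<forall>\<sigma>. rr_reachable I X \<sigma> \<and> \<not> rr_halted I X \<sigma> \<longrightarrow> (\<exists>\<sigma>'. rr_step I X \<sigma> \<sigma>'))"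

definition rr_outputs :: "'v sa_instance \<Rightarrow> side \<Rightarrow> 'v set set \<Rightarrow> bool" where
  "rr_outputs I X M \<longleftrightarrow> (\<exists>F. rr_reachable I X (M, F) \<and> rr_halted I X (M, F))"

end

theory Submission
  imports Defs "HOL-Library.Multiset" "HOL-Combinatorics.Orbits"
begin

text \<open>Call two assignments compatible if neither blocks the other. Double counting edges shows
  that two compatible assignments are polarized: an agent with different mates in the two
  assignments is full in both of them and favours one, and the agents at the other ends of the
  edges in which they differ favour the other one. This does not depend on the side of the
  agent.

  Let \<open>x'\<close> point to \<open>y\<close> in the rotation digraph of \<open>M\<close>, and let \<open>y\<close> point to a sink \<open>x\<close>. If a
  compatible \<open>N\<close> contained \<open>x'y\<close>, then \<open>x\<close> would lose \<open>y\<close> on the way from \<open>M\<close> to \<open>N\<close>, and its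
  new mate in \<open>N\<close> would be a candidate for \<open>s\<^sub>M(x)\<close>. So the algorithm deletes only edges that
  are not legal. Eliminating a rotation from a legal assignment gives a legal assignment, and
  when no arcs are left the current assignment is optimal among all legal ones.

  A set of assignments is legal exactly if its edge set is a fixed point of the antitone map
  \<open>covered\<close>, which sends an edge set \<open>F\<close> to the union of the assignments that \<open>F\<close> does not
  block. The least fixed point \<open>lower\<close> of the square of this map and \<open>upper = covered lower\<close>
  enclose all its fixed points. An edge of \<open>upper\<close> lies in an assignment compatible with all
  stable assignments of \<open>upper\<close>, so rotations lead through such stable assignments to one that
  contains the edge. Hence \<open>lower = upper\<close>, and there is exactly one legal set.\<close>

section \<open>Finite linear orders and incidence counts\<close>

lemma ex_greatest_of_strict_linear_order:
  assumes "strict_linear_order_on A r" "finite S" "S \<noteq> {}" "S \<subseteq> A"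
  shows "\<exists>y \<in> S. \<forall>y' \<in> S. y' = y \<or> (y', y) \<in> r"
  using assms(2-4)
proof (induction S rule: finite_ne_induct)
  case (insert x S)
  then obtain y where y: "y \<in> S" "\<forall>y' \<in> S. y' = y \<or> (y', y) \<in> r" by auto
  have "x = y \<or> (x, y) \<in> r \<or> (y, x) \<in> r"
    using assms(1) insert.prems y(1) by (auto simp: strict_linear_order_on_def total_on_def)
  moreover have "trans r" using assms(1) by (simp add: strict_linear_order_on_def)
  ultimately show ?case using y by (metis insert_iff transE)
qed simp

lemma strict_linear_order_on_converse:
  "strict_linear_order_on A r \<Longrightarrow> strict_linear_order_on A (r\<inverse>)"
  by (simp add: strict_linear_order_on_def)

lemma ex_least_of_strict_linear_order:
  assumes "strict_linear_order_on A r" "finite S" "S \<noteq> {}" "S \<subseteq> A"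
  shows "\<exists>x \<in> S. \<forall>x' \<in> S. x' = x \<or> (x, x') \<in> r"
  using strict_linear_order_on_converse[OF assms(1), THEN ex_greatest_of_strict_linear_order]
    assms(2-) by simp

definition elements_above :: "'a rel \<Rightarrow> 'a set \<Rightarrow> 'a \<Rightarrow> 'a set" where
  "elements_above r S w = {w' \<in> S. (w, w') \<in> r}"

definition top_elements :: "'a rel \<Rightarrow> nat \<Rightarrow> 'a set \<Rightarrow> 'a set" where
  "top_elements r q S = {w \<in> S. card (elements_above r S w) < q}"

lemma card_elements_above_antimono:
  assumes "trans r" "finite S" "w = w' \<or> (w, w') \<in> r"
  shows "card (elements_above r S w') \<le> card (elements_above r S w)"
  using assms by (intro card_mono) (auto simp: elements_above_def dest: transD)

lemma card_top_elements_le: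
  assumes "strict_linear_order_on A r" "finite S" "S \<subseteq> A"
  shows "card (top_elements r q S) \<le> q"
proof (cases "top_elements r q S = {}")
  case False
  let ?T = "top_elements r q S"
  have T: "?T \<subseteq> S" "finite ?T" using assms(2) by (auto simp: top_elements_def)
  obtain t where t: "t \<in> ?T" "\<forall>t' \<in> ?T. t' = t \<or> (t, t') \<in> r"
    using ex_least_of_strict_linear_order[OF assms(1) T(2) False] T(1) assms(3) by auto
  have "card (?T - {t}) \<le> card (elements_above r S t)"
    using t(2) T assms(2) by (intro card_mono) (auto simp: elements_above_def)
  moreover have "card (elements_above r S t) < q" using t(1) by (simp add: top_elements_def)
  moreover have "card ?T = Suc (card (?T - {t}))" using card_Suc_Diff1[OF T(2) t(1)] by simp
  ultimately show ?thesis by linarith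
qed simp

lemma card_top_elements_if_surpassed:
  assumes order: "strict_linear_order_on A r" and S: "finite S" "S \<subseteq> A"
    and w: "w \<in> A" "q \<le> card (elements_above r S w)"
  shows "card (top_elements r q S) = q" and "t \<in> top_elements r q S \<Longrightarrow> (w, t) \<in> r"
proof -
  let ?T = "top_elements r q S" and ?W = "elements_above r S w"
  have trans: "trans r" and irrefl: "irrefl r" and total: "total_on A r"
    using order by (simp_all add: strict_linear_order_on_def)
  have T: "finite ?T" using S(1) by (simp add: top_elements_def)
  show "(w, t) \<in> r" if "t \<in> ?T" for t
  proof (rule ccontr)
    assume "(w, t) \<notin> r"
    then have "t = w \<or> (t, w) \<in> r"
      using total w(1) that S(2) by (auto simp: total_on_def top_elements_def)
    then have "card ?W \<le> card (elements_above r S t)"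
      by (rule card_elements_above_antimono[OF trans S(1)])
    then show False using w(2) that by (simp add: top_elements_def)
  qed
  have "\<not> card ?T < q"
  proof
    assume less: "card ?T < q"
    then have "\<not> ?W \<subseteq> ?T" using card_mono[OF T, of ?W] w(2) by auto
    then obtain u where u: "u \<in> ?W - ?T" "\<forall>u' \<in> ?W - ?T. u' = u \<or> (u', u) \<in> r"
      using ex_greatest_of_strict_linear_order[OF order, of "?W - ?T"] S
      by (auto simp: elements_above_def)
    have "elements_above r S u \<subseteq> ?T"
    proof
      fix u' assume "u' \<in> elements_above r S u"
      then have u': "u' \<in> S" "(u, u') \<in> r" by (auto simp: elements_above_def)
      then have "u' \<in> ?W" using u(1) transD[OF trans, of w u u'] by (simp add: elements_above_def)
      moreover have "u' \<noteq> u" "(u', u) \<notin> r"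
        using u'(2) irreflD[OF irrefl] transD[OF trans, of u u' u] by auto
      ultimately show "u' \<in> ?T" using u(2) by blast
    qed
    then have "card (elements_above r S u) < q"
      using card_mono[OF T, of "elements_above r S u"] less by linarith
    then show False using u(1) by (auto simp: top_elements_def elements_above_def)
  qed
  then show "card ?T = q" using card_top_elements_le[OF order S, of q] by simp
qed

lemma card_le_sum_incident:
  assumes "finite V" "finite J" "\<And>e. e \<in> J \<Longrightarrow> V \<inter> e \<noteq> {}"
  shows "card J \<le> (\<Sum>v\<in>V. card {e \<in> J. v \<in> e})"
proof -
  have "J = (\<Union>v\<in>V. {e \<in> J. v \<in> e})" using assms(3) by blast
  then show ?thesis using card_UN_le[OF assms(1), of "\<lambda>v. {e \<in> J. v \<in> e}"] by simp
qed

lemma sum_incident_eq_card: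
  assumes "finite V" "finite J"
    and "\<And>e v w. e \<in> J \<Longrightarrow> v \<in> V \<inter> e \<Longrightarrow> w \<in> V \<inter> e \<Longrightarrow> v = w"
  shows "(\<Sum>v\<in>V. card {e \<in> J. v \<in> e}) = card {e \<in> J. V \<inter> e \<noteq> {}}"
proof -
  have "card (\<Union>v\<in>V. {e \<in> J. v \<in> e}) = (\<Sum>v\<in>V. card {e \<in> J. v \<in> e})"
    using assms by (intro card_UN_disjoint) auto
  moreover have "(\<Union>v\<in>V. {e \<in> J. v \<in> e}) = {e \<in> J. V \<inter> e \<noteq> {}}" by blast
  ultimately show ?thesis by simp
qed

section \<open>Two-sided markets with quotas\<close>

lemma mem_mates_iff: "w \<in> mates M v \<longleftrightarrow> {v, w} \<in> M"
  by (simp add: mates_def)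

lemma mates_commute: "w \<in> mates M v \<longleftrightarrow> v \<in> mates M w"
  by (simp add: mates_def insert_commute)

lemma mates_mono: "M \<subseteq> N \<Longrightarrow> mates M v \<subseteq> mates N v"
  by (auto simp: mates_def)

lemma mates_Diff: "mates (M - N) v = mates M v - mates N v"
  by (auto simp: mates_def)

lemma opposite_opposite [simp]: "opposite (opposite X) = X"
  by (cases X) auto

text \<open>Without conditions on the quotas the two sides are interchangeable. That students have quota 1
  only matters for the notions of the paper that compare single partners.\<close>

locale two_sided_market =
  fixes I :: "'v sa_instance"
  assumes finite_students: "finite (students I)"
    and finite_schools: "finite (schools I)"
    and disjoint_sides: "students I \<inter> schools I = {}"
    and edges_subset: "edges I \<subseteq> {{a, b} |a b. a \<in> students I \<and> b \<in> schools I}"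
    and pref_subset: "v \<in> students I \<union> schools I \<Longrightarrow>
      pref_less I v \<subseteq> mates (edges I) v \<times> mates (edges I) v"
    and pref_linear: "v \<in> students I \<union> schools I \<Longrightarrow>
      strict_linear_order_on (mates (edges I) v) (pref_less I v)"
begin

abbreviation less_pref :: "'v \<Rightarrow> 'v \<Rightarrow> 'v \<Rightarrow> bool"  (\<open>(_ \<prec>\<^bsub>_\<^esub> _)\<close> [51, 0, 51] 50)
  where "y' \<prec>\<^bsub>v\<^esub> y \<equiv> (y', y) \<in> pref_less I v"

abbreviation vertices :: "'v set" where
  "vertices \<equiv> students I \<union> schools I"

lemma agents_disjoint: "agents I X \<inter> agents I (opposite X) = {}"
  using disjoint_sides by (cases X) auto

lemma agents_subset_vertices: "agents I X \<subseteq> vertices"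
  by (cases X) auto

lemma vertices_eq_agents: "vertices = agents I X \<union> agents I (opposite X)"
  by (cases X) auto

lemma finite_agents: "finite (agents I X)"
  by (cases X) (auto simp: finite_students finite_schools)

lemma edge_agents:
  assumes "e \<in> edges I"
  shows "\<exists>x \<in> agents I X. \<exists>y \<in> agents I (opposite X). e = {x, y}"
proof -
  obtain a b where "e = {a, b}" "a \<in> students I" "b \<in> schools I"
    using assms edges_subset by blast
  then show ?thesis by (cases X) (auto simp: doubleton_eq_iff)
qed

lemma finite_edges: "finite (edges I)"
proof (rule finite_subset)
  show "edges I \<subseteq> (\<lambda>(a, b). {a, b}) ` (students I \<times> schools I)"
    using edges_subset by auto
qed (simp add: finite_students finite_schools)

lemma mates_subset_agents:
  assumes "x \<in> agents I X" "M \<subseteq> edges I"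
  shows "mates M x \<subseteq> agents I (opposite X)"
proof
  fix y assume "y \<in> mates M x"
  then have "{x, y} \<in> edges I" using assms(2) by (auto simp: mem_mates_iff)
  then obtain x' y' where "{x, y} = {x', y'}" "x' \<in> agents I X" "y' \<in> agents I (opposite X)"
    using edge_agents by blast
  then show "y \<in> agents I (opposite X)"
    using assms(1) agents_disjoint[of X] by (auto simp: doubleton_eq_iff)
qed

lemma mates_vertices:
  assumes "M \<subseteq> edges I" "w \<in> mates M v"
  shows "v \<in> vertices" "w \<in> vertices"
proof -
  have "{v, w} \<in> edges I" using assms by (auto simp: mem_mates_iff)
  then obtain x y where xy: "{v, w} = {x, y}" "x \<in> agents I Students" "y \<in> agents I Schools"
    using edge_agents[of "{v, w}" Students] by auto
  then have "v = x \<and> w = y \<or> v = y \<and> w = x" by (simp add: doubleton_eq_iff)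
  then show "v \<in> vertices" "w \<in> vertices" using xy(2,3) by auto
qed

lemma finite_mates:
  assumes "M \<subseteq> edges I"
  shows "finite (mates M v)"
proof (rule finite_subset)
  show "mates M v \<subseteq> vertices" using mates_vertices(2)[OF assms] by blast
qed (simp add: finite_students finite_schools)

lemma less_pref_trans: "v \<in> vertices \<Longrightarrow> x \<prec>\<^bsub>v\<^esub> y \<Longrightarrow> y \<prec>\<^bsub>v\<^esub> z \<Longrightarrow> x \<prec>\<^bsub>v\<^esub> z"
  using pref_linear unfolding strict_linear_order_on_def trans_def by blast

lemma less_pref_irrefl: "v \<in> vertices \<Longrightarrow> \<not> x \<prec>\<^bsub>v\<^esub> x"
  using pref_linear unfolding strict_linear_order_on_def irrefl_def by blast

lemma less_pref_asym: "v \<in> vertices \<Longrightarrow> x \<prec>\<^bsub>v\<^esub> y \<Longrightarrow> \<not> y \<prec>\<^bsub>v\<^esub> x"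
  using less_pref_trans less_pref_irrefl by blast

lemma less_pref_total:
  "v \<in> vertices \<Longrightarrow> x \<in> mates (edges I) v \<Longrightarrow> y \<in> mates (edges I) v \<Longrightarrow>
    x = y \<or> x \<prec>\<^bsub>v\<^esub> y \<or> y \<prec>\<^bsub>v\<^esub> x"
  using pref_linear unfolding strict_linear_order_on_def total_on_def by blast

lemma card_incident_edges:
  assumes "J \<subseteq> edges I"
  shows "card {e \<in> J. v \<in> e} = card (mates J v)"
proof -
  have "{e \<in> J. v \<in> e} = (\<lambda>w. {v, w}) ` mates J v"
  proof (intro equalityI subsetI)
    fix e assume e: "e \<in> {e \<in> J. v \<in> e}"
    then obtain a b where "e = {a, b}" using assms edge_agents[of e Students] by blast
    then show "e \<in> (\<lambda>w. {v, w}) ` mates J v"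
      using e by (auto simp: mates_def insert_commute)
  qed (auto simp: mates_def)
  moreover have "inj_on (\<lambda>w. {v, w}) (mates J v)"
    by (auto simp: inj_on_def doubleton_eq_iff)
  ultimately show ?thesis by (simp add: card_image)
qed

lemma assignment_iff:
  "assignment I M \<longleftrightarrow> M \<subseteq> edges I \<and> (\<forall>v \<in> vertices. card (mates M v) \<le> quota I v)"
  unfolding assignment_def using card_incident_edges by auto

lemma assignment_edges: "assignment I M \<Longrightarrow> M \<subseteq> edges I"
  by (simp add: assignment_iff)

lemma assignment_card: "assignment I M \<Longrightarrow> v \<in> vertices \<Longrightarrow> card (mates M v) \<le> quota I v"
  by (simp add: assignment_iff)

lemma assignment_finite_mates: "assignment I M \<Longrightarrow> finite (mates M v)"
  by (simp add: assignment_edges finite_mates)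

lemma subset_of_mates_eq:
  assumes "M \<subseteq> edges I" "\<And>x. x \<in> agents I X \<Longrightarrow> mates M x = mates N x"
  shows "M \<subseteq> N"
proof
  fix e assume e: "e \<in> M"
  then obtain x y where "e = {x, y}" "x \<in> agents I X"
    using assms(1) edge_agents[of e X] by blast
  then show "e \<in> N" using e assms(2)[of x] by (auto simp: mem_mates_iff[symmetric])
qed

definition admits :: "'v set set \<Rightarrow> 'v \<Rightarrow> 'v \<Rightarrow> bool" where
  "admits M v w \<longleftrightarrow> card (mates M v) < quota I v \<or> (\<exists>w' \<in> mates M v. w' \<prec>\<^bsub>v\<^esub> w)"

lemma not_admitsD:
  assumes "assignment I M" "v \<in> vertices" "w \<in> mates (edges I) v" "\<not> admits M v w"
  shows "card (mates M v) = quota I v" and "w' \<in> mates M v \<Longrightarrow> w = w' \<or> w \<prec>\<^bsub>v\<^esub> w'"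
proof -
  show "card (mates M v) = quota I v"
    using assms assignment_card[of M v] by (auto simp: admits_def)
  show "w = w' \<or> w \<prec>\<^bsub>v\<^esub> w'" if "w' \<in> mates M v"
    using less_pref_total[OF assms(2,3), of w'] assms(4) that
      mates_mono[OF assignment_edges[OF assms(1)]] by (auto simp: admits_def)
qed

definition unblocked :: "'v set set \<Rightarrow> 'v set set \<Rightarrow> bool" where
  "unblocked K M \<longleftrightarrow> (\<forall>v w. {v, w} \<in> K - M \<longrightarrow> \<not> (admits M v w \<and> admits M w v))"

lemma unblocked_mono: "unblocked K M \<Longrightarrow> J \<subseteq> K \<Longrightarrow> unblocked J M"
  by (auto simp: unblocked_def)

lemma unblockedD:
  "unblocked K M \<Longrightarrow> w \<in> mates K v \<Longrightarrow> w \<notin> mates M v \<Longrightarrow> admits M v w \<Longrightarrow> \<not> admits M w v"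
  by (auto simp: unblocked_def mem_mates_iff)

lemma unblockedI_side:
  assumes "K \<subseteq> edges I"
    and "\<And>x y. x \<in> agents I X \<Longrightarrow> y \<in> mates K x - mates M x \<Longrightarrow>
      \<not> (admits M x y \<and> admits M y x)"
  shows "unblocked K M"
  unfolding unblocked_def
proof (intro allI impI)
  fix v w assume vw: "{v, w} \<in> K - M"
  then obtain x y where xy: "{v, w} = {x, y}" "x \<in> agents I X"
    using assms(1) edge_agents[of "{v, w}" X] by blast
  then have "\<not> (admits M x y \<and> admits M y x)"
    using vw assms(2)[of x y] by (simp add: mem_mates_iff)
  then show "\<not> (admits M v w \<and> admits M w v)"
    using xy(1) by (auto simp: doubleton_eq_iff)
qed

section \<open>Compatible assignments\<close>

definition compatible :: "'v set set \<Rightarrow> 'v set set \<Rightarrow> bool" where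
  "compatible M N \<longleftrightarrow> assignment I M \<and> assignment I N \<and> unblocked M N \<and> unblocked N M"

definition favours :: "'v set set \<Rightarrow> 'v set set \<Rightarrow> 'v \<Rightarrow> bool" where
  "favours M N v \<longleftrightarrow> (\<exists>w \<in> mates N v - mates M v. \<not> admits M v w)"

lemma compatible_sym: "compatible M N \<Longrightarrow> compatible N M"
  by (simp add: compatible_def)

lemma compatibleD:
  assumes "compatible M N"
  shows "assignment I M" "assignment I N" "M \<subseteq> edges I" "N \<subseteq> edges I"
  using assms by (auto simp: compatible_def assignment_edges)

lemma favours_full:
  assumes "assignment I M" "N \<subseteq> edges I" "favours M N v"
  shows "card (mates M v) = quota I v"
proof -
  obtain w where w: "w \<in> mates N v" "\<not> admits M v w" using assms(3) by (auto simp: favours_def)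
  show ?thesis
    using not_admitsD(1)[OF assms(1) mates_vertices(1)[OF assms(2) w(1)] _ w(2)] w(1)
      mates_mono[OF assms(2)] by blast
qed

lemma admits_if_favours:
  assumes "assignment I M" "N \<subseteq> edges I" "favours M N v" "w \<in> mates M v - mates N v"
  shows "admits N v w"
proof -
  obtain u where u: "u \<in> mates N v - mates M v" "\<not> admits M v u"
    using assms(3) by (auto simp: favours_def)
  then have "u \<prec>\<^bsub>v\<^esub> w"
    using not_admitsD(2)[OF assms(1) mates_vertices(1)[OF assms(2)] _ u(2), of u w]
      mates_mono[OF assms(2), of v] assms(4) by blast
  then show ?thesis using u(1) by (auto simp: admits_def)
qed

lemma favours_asym:
  assumes "assignment I M" "N \<subseteq> edges I" "favours M N v"
  shows "\<not> favours N M v"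
  using admits_if_favours[OF assms] by (auto simp: favours_def)

lemma favouring_endpoint:
  assumes "compatible M N" "{v, w} \<in> N - M"
  shows "favours M N v \<or> favours M N w"
proof -
  have "\<not> admits M v w \<or> \<not> admits M w v"
    using assms by (auto simp: compatible_def unblocked_def)
  then show ?thesis using assms(2) by (auto simp: favours_def mem_mates_iff insert_commute)
qed

lemma favouring_endpoint_unique:
  assumes "compatible M N" "{v, w} \<in> M - N"
  shows "\<not> (favours M N v \<and> favours M N w)"
proof -
  have "w \<in> mates M v - mates N v" "v \<in> mates M w - mates N w"
    using assms(2) by (auto simp: mem_mates_iff insert_commute)
  moreover have "\<not> (admits N v w \<and> admits N w v)"
    using assms by (auto simp: compatible_def unblocked_def)
  ultimately show ?thesis using admits_if_favours compatibleD[OF assms(1)] by blast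
qed

definition favouring :: "'v set set \<Rightarrow> 'v set set \<Rightarrow> 'v set" where
  "favouring M N = {v \<in> vertices. favours M N v}"

lemma finite_favouring: "finite (favouring M N)"
  by (simp add: favouring_def finite_students finite_schools)

lemma card_Diff_le_sum_favouring:
  assumes "compatible M N"
  shows "card (N - M) \<le> (\<Sum>v\<in>favouring M N. card (mates N v - mates M v))"
proof -
  have N: "N \<subseteq> edges I" by (rule compatibleD(4)[OF assms])
  have "card (N - M) \<le> (\<Sum>v\<in>favouring M N. card {e \<in> N - M. v \<in> e})"
  proof (rule card_le_sum_incident[OF finite_favouring])
    show "finite (N - M)" using finite_subset[OF N finite_edges] by simp
    fix e assume e: "e \<in> N - M"
    then obtain v w where "e = {v, w}" "v \<in> vertices" "w \<in> vertices"
      using N edge_agents[of e Students] by auto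
    then show "favouring M N \<inter> e \<noteq> {}"
      using favouring_endpoint[OF assms] e by (auto simp: favouring_def)
  qed
  moreover have "card {e \<in> N - M. v \<in> e} = card (mates N v - mates M v)" for v
    using N by (subst card_incident_edges) (auto simp: mates_Diff)
  ultimately show ?thesis by simp
qed

lemma sum_favouring_eq_card:
  assumes "compatible M N"
  shows "(\<Sum>v\<in>favouring M N. card (mates M v - mates N v)) =
    card {e \<in> M - N. favouring M N \<inter> e \<noteq> {}}"
proof -
  have M: "M \<subseteq> edges I" by (rule compatibleD(3)[OF assms])
  have "(\<Sum>v\<in>favouring M N. card {e \<in> M - N. v \<in> e}) =
      card {e \<in> M - N. favouring M N \<inter> e \<noteq> {}}"
  proof (rule sum_incident_eq_card[OF finite_favouring])
    show "finite (M - N)" using finite_subset[OF M finite_edges] by simp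
    fix e v w assume e: "e \<in> M - N" "v \<in> favouring M N \<inter> e" "w \<in> favouring M N \<inter> e"
    then obtain v' w' where "e = {v', w'}" using M edge_agents[of e Students] by blast
    then show "v = w"
      using e favouring_endpoint_unique[OF assms, of v' w'] by (auto simp: favouring_def)
  qed
  moreover have "card {e \<in> M - N. v \<in> e} = card (mates M v - mates N v)" for v
    using M by (subst card_incident_edges) (auto simp: mates_Diff)
  ultimately show ?thesis by simp
qed

lemma card_mates_le_if_favours:
  assumes "assignment I M" "assignment I N" "v \<in> favouring M N"
  shows "card (mates N v) \<le> card (mates M v)"
  using assms favours_full[of M N v] assignment_card[of N v] assignment_edges[of N]
  by (simp add: favouring_def)

text \<open>Every edge of \<open>N - M\<close> has an endpoint that favours \<open>M\<close>, and every edge of \<open>M - N\<close> has at most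
  one. As an agent favouring \<open>M\<close> has at least as many mates in \<open>M\<close> as in \<open>N\<close>, double counting the
  edges at these agents compares \<open>N - M\<close> with \<open>M - N\<close>.\<close>

lemma compatible_card_Diff:
  assumes "compatible M N"
  shows "card (N - M) \<le> card (M - N)"
    and "card (N - M) = card (M - N) \<Longrightarrow> v \<in> favouring M N \<Longrightarrow>
      card (mates N v) = card (mates M v)"
    and "card (N - M) = card (M - N) \<Longrightarrow> e \<in> M - N \<Longrightarrow> favouring M N \<inter> e \<noteq> {}"
proof -
  let ?V = "favouring M N"
  have fin: "finite (mates M v)" "finite (mates N v)" for v
    using compatibleD(3,4)[OF assms] finite_mates by auto
  have fin_Diff: "finite (M - N)"
    using finite_subset[OF compatibleD(3)[OF assms] finite_edges] by simp
  note lower = card_Diff_le_sum_favouring[OF assms] and upper = sum_favouring_eq_card[OF assms]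
  have at_v: "card (mates N v - mates M v) \<le> card (mates M v - mates N v)" if "v \<in> ?V" for v
    using card_le_sym_Diff[OF fin(2) fin(1)] card_mates_le_if_favours[OF compatibleD(1,2)[OF assms]]
      that by blast
  then have middle: "(\<Sum>v\<in>?V. card (mates N v - mates M v)) \<le> (\<Sum>v\<in>?V. card (mates M v - mates N v))"
    by (rule sum_mono)
  have favoured: "card {e \<in> M - N. ?V \<inter> e \<noteq> {}} \<le> card (M - N)"
    using fin_Diff by (intro card_mono) auto
  show "card (N - M) \<le> card (M - N)" using lower middle upper favoured by linarith
  assume card_eq: "card (N - M) = card (M - N)"
  show "card (mates N v) = card (mates M v)" if "v \<in> ?V"
  proof -
    have "card (mates N v - mates M v) = card (mates M v - mates N v)"
      by (rule sum_mono_inv[OF _ at_v that finite_favouring])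
        (use card_eq lower middle upper favoured in auto)
    then show ?thesis
      using fin card_Int_Diff[of "mates N v" "mates M v"] card_Int_Diff[of "mates M v" "mates N v"]
      by (simp add: Int_commute)
  qed
  have "{e \<in> M - N. ?V \<inter> e \<noteq> {}} = M - N"
    using card_eq lower middle upper favoured fin_Diff by (intro card_subset_eq) auto
  then show "?V \<inter> e \<noteq> {}" if "e \<in> M - N" using that by blast
qed

lemma compatible_card_Diff_eq:
  assumes "compatible M N"
  shows "card (N - M) = card (M - N)"
  using compatible_card_Diff(1)[OF assms] compatible_card_Diff(1)[OF compatible_sym[OF assms]]
  by simp

lemma compatible_polarized:
  assumes "compatible M N" "w \<in> mates N v - mates M v"
  shows "favours M N v \<and> favours N M w \<or> favours N M v \<and> favours M N w"
proof -
  have sym: "compatible N M" using assms(1) by (rule compatible_sym)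
  have edge: "{v, w} \<in> N - M" using assms(2) by (simp add: mem_mates_iff)
  have "favours N M v \<or> favours N M w"
    using compatible_card_Diff(3)[OF sym compatible_card_Diff_eq[OF sym] edge]
    by (auto simp: favouring_def)
  then show ?thesis
    using favouring_endpoint[OF assms(1) edge] favours_asym compatibleD[OF assms(1)] by blast
qed

lemma compatible_favours_iff:
  assumes "compatible M N" "w \<in> mates M v \<longleftrightarrow> w \<notin> mates N v"
  shows "favours M N w \<longleftrightarrow> favours N M v"
  using compatible_polarized[OF assms(1), of w v]
    compatible_polarized[OF compatible_sym[OF assms(1)], of w v]
    assms(2) favours_asym compatibleD[OF assms(1)] by blast

lemma compatible_favours_cases:
  assumes "compatible M N" "mates M v \<noteq> mates N v"
  shows "favours M N v \<or> favours N M v"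
proof -
  obtain w where "w \<in> mates M v \<longleftrightarrow> w \<notin> mates N v" using assms(2) by blast
  then show ?thesis
    using compatible_polarized[OF assms(1), of w v]
      compatible_polarized[OF compatible_sym[OF assms(1)], of w v] by blast
qed

lemma favours_card_eq:
  assumes "compatible M N" "favours M N v"
  shows "card (mates N v) = card (mates M v)"
proof -
  have "v \<in> vertices"
    using assms mates_vertices(1)[OF compatibleD(4)[OF assms(1)]] by (auto simp: favours_def)
  then show ?thesis
    using compatible_card_Diff(2)[OF assms(1) compatible_card_Diff_eq[OF assms(1)]] assms(2)
    by (simp add: favouring_def)
qed

lemma favours_Diff_nonempty:
  assumes "compatible M N" "favours M N v"
  shows "mates M v - mates N v \<noteq> {}"
proof
  assume "mates M v - mates N v = {}"
  moreover have "finite (mates N v)" using finite_mates[OF compatibleD(4)[OF assms(1)]] .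
  ultimately have "mates M v = mates N v"
    using card_subset_eq[of "mates N v" "mates M v"] favours_card_eq[OF assms] by auto
  then show False using assms(2) by (auto simp: favours_def)
qed

lemma compatible_mates_full:
  assumes "compatible M N" "mates M v \<noteq> mates N v"
  shows "card (mates M v) = quota I v" "card (mates N v) = quota I v"
  using compatible_favours_cases[OF assms] favours_full[of M N v] favours_full[of N M v]
    favours_card_eq[OF assms(1), of v] favours_card_eq[OF compatible_sym[OF assms(1)], of v]
    compatibleD[OF assms(1)] by auto

lemma favours_not_admits:
  assumes "compatible M N" "favours M N v" "w \<in> mates N v - mates M v"
  shows "\<not> admits M v w"
proof
  assume admits: "admits M v w"
  have "\<not> admits M w v"
    using assms(1,3) admits unblockedD[of N M w v] by (simp add: compatible_def)
  then have "favours M N w"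
    using assms(3) mates_commute[of w _ v] by (auto simp: favours_def)
  then have "favours N M v" using compatible_favours_iff[OF assms(1), of w v] assms(3) by blast
  then show False using favours_asym assms(2) compatibleD[OF assms(1)] by blast
qed

lemma favours_less_pref:
  assumes "compatible M N" "favours M N v" "w \<in> mates N v - mates M v" "u \<in> mates M v"
  shows "w \<prec>\<^bsub>v\<^esub> u"
proof -
  note M = compatibleD(1)[OF assms(1)] and N = compatibleD(4)[OF assms(1)]
  have "w \<in> mates (edges I) v" using assms(3) mates_mono[OF N] by blast
  then show ?thesis
    using not_admitsD(2)[OF M mates_vertices(1)[OF N] _ favours_not_admits[OF assms(1-3)] assms(4)]
      assms(3,4) by blast
qed

lemma favours_sides_iff:
  assumes "compatible M N"
  shows "(\<forall>x \<in> agents I X. \<not> favours M N x) \<longleftrightarrow> (\<forall>y \<in> agents I (opposite X). \<not> favours N M y)"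
proof -
  have "\<forall>y \<in> agents I (opposite X). \<not> favours N M y"
    if none: "\<forall>x \<in> agents I X. \<not> favours M N x" and compat: "compatible M N" for M N X
  proof (intro ballI notI)
    fix y assume y: "y \<in> agents I (opposite X)" "favours N M y"
    then obtain x where x: "x \<in> mates M y - mates N y" by (auto simp: favours_def)
    then have "x \<in> agents I X" using mates_subset_agents[OF y(1) compatibleD(3)[OF compat]] by auto
    moreover have "favours M N x" using compatible_favours_iff[OF compat, of x y] x y(2) by blast
    ultimately show False using none by blast
  qed
  from this[of X M N] this[of "opposite X" N M] show ?thesis
    using assms compatible_sym by auto
qed

lemma mates_eq_if_none_favours:
  assumes "compatible M N"
    and "\<forall>x \<in> agents I X. \<not> favours M N x" "\<forall>x \<in> agents I X. \<not> favours N M x"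
  shows "M = N"
proof -
  have "mates M x = mates N x" if "x \<in> agents I X" for x
    using compatible_favours_cases[OF assms(1)] assms(2,3) that by blast
  then show ?thesis
    using subset_of_mates_eq[of M X N] subset_of_mates_eq[of N X M] compatibleD[OF assms(1)] by auto
qed

section \<open>Stable assignments of a subgraph\<close>

definition stable_in :: "'v set set \<Rightarrow> 'v set set \<Rightarrow> bool" where
  "stable_in F M \<longleftrightarrow> assignment I M \<and> M \<subseteq> F \<and> unblocked F M"

lemma stable_in_compatible:
  assumes "stable_in F M" "stable_in F N"
  shows "compatible M N"
  using assms unblocked_mono by (auto simp: stable_in_def compatible_def)

text \<open>\<open>surplus Z E\<close> consists of the edges that the agents on side \<open>Z\<close> turn down when each of them
  picks its best edges from \<open>E\<close> up to its quota. As in Fleiner's lattice theoretic proof of the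
  Gale-Shapley theorem, the stable assignments of \<open>F\<close> correspond to the fixed points \<open>E\<close> of the
  monotone map \<open>offer_step Z F\<close>, and the greatest one is the best for \<open>Z\<close>.\<close>

definition surplus :: "side \<Rightarrow> 'v set set \<Rightarrow> 'v set set" where
  "surplus Z E = {{v, w} |v w. v \<in> agents I Z \<and> w \<in> agents I (opposite Z) \<and>
     quota I v \<le> card (elements_above (pref_less I v) (mates E v) w)}"

definition offers :: "side \<Rightarrow> 'v set set \<Rightarrow> 'v set set \<Rightarrow> 'v set set" where
  "offers Z F M = M \<union> {{v, w} |v w. v \<in> agents I Z \<and> w \<in> mates F v \<and> admits M v w}"

definition offer_step :: "side \<Rightarrow> 'v set set \<Rightarrow> 'v set set \<Rightarrow> 'v set set" where
  "offer_step Z F E = F - surplus (opposite Z) (F - surplus Z (E \<inter> F))"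

lemma surplus_iff:
  assumes "v \<in> agents I Z" "w \<in> agents I (opposite Z)"
  shows "{v, w} \<in> surplus Z E \<longleftrightarrow>
    quota I v \<le> card (elements_above (pref_less I v) (mates E v) w)"
proof
  assume "{v, w} \<in> surplus Z E"
  then obtain v' w' where "{v, w} = {v', w'}" "v' \<in> agents I Z" "w' \<in> agents I (opposite Z)"
      "quota I v' \<le> card (elements_above (pref_less I v') (mates E v') w')"
    by (auto simp: surplus_def)
  moreover from this have "v = v' \<and> w = w'"
    using assms agents_disjoint[of Z] by (auto simp: doubleton_eq_iff)
  ultimately show "quota I v \<le> card (elements_above (pref_less I v) (mates E v) w)" by simp
qed (use assms in \<open>auto simp: surplus_def\<close>)

lemma surplus_mono:
  assumes "E \<subseteq> E'" "E' \<subseteq> edges I"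
  shows "surplus Z E \<subseteq> surplus Z E'"
proof -
  have "card (elements_above r (mates E v) w) \<le> card (elements_above r (mates E' v) w)" for r v w
    using mates_mono[OF assms(1)] finite_mates[OF assms(2)]
    by (intro card_mono) (auto simp: elements_above_def)
  then show ?thesis unfolding surplus_def using order_trans by blast
qed

lemma mono_offer_step: "F \<subseteq> edges I \<Longrightarrow> mono (offer_step Z F)"
  unfolding offer_step_def by (intro monoI Diff_mono order_refl surplus_mono) auto

lemma mates_offers:
  assumes "M \<subseteq> F" "F \<subseteq> edges I" "v \<in> agents I Z"
  shows "mates (offers Z F M) v = mates M v \<union> {w \<in> mates F v. admits M v w}"
proof -
  have "v \<notin> mates F u" if "u \<in> agents I Z" for u
    using mates_subset_agents[OF that assms(2)] agents_disjoint[of Z] assms(3) by blast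
  then have "(\<exists>u t. {v, w} = {u, t} \<and> u \<in> agents I Z \<and> t \<in> mates F u \<and> admits M u t) \<longleftrightarrow>
      w \<in> mates F v \<and> admits M v w" for w
    using assms(3) by (auto simp: doubleton_eq_iff)
  then show ?thesis unfolding offers_def by (auto simp: mates_def)
qed

lemma mem_mates_offers_opposite:
  assumes "F \<subseteq> edges I" "v \<in> agents I Z" "w \<in> mates (offers (opposite Z) F M) v - mates M v"
  shows "w \<in> mates F v \<and> admits M w v"
proof -
  obtain v' w' where "{v, w} = {w', v'}" "w' \<in> agents I (opposite Z)" "v' \<in> mates F w'"
      "admits M w' v'"
    using assms(3) by (auto simp: offers_def mem_mates_iff)
  moreover from this have "v = v' \<and> w = w'"
    using assms(2) agents_disjoint[of Z] by (auto simp: doubleton_eq_iff)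
  ultimately show ?thesis using mates_commute by metis
qed

lemma card_elements_above_less_quota:
  assumes M: "assignment I M" and v: "v \<in> vertices" and S: "finite S"
    and rejected: "\<And>u. u \<in> S - mates M v \<Longrightarrow> \<not> admits M v u"
    and kept: "w \<in> mates M v \<or> admits M v w"
  shows "card (elements_above (pref_less I v) S w) < quota I v"
proof -
  let ?W = "elements_above (pref_less I v) S w"
  have fin: "finite (mates M v)" by (rule assignment_finite_mates[OF M])
  consider (unfilled) "card (mates M v) < quota I v"
    | (replaceable) w' where "w' \<in> mates M v" "w' = w \<or> w' \<prec>\<^bsub>v\<^esub> w"
    using kept by (auto simp: admits_def)
  then show ?thesis
  proof cases
    case unfilled
    then have "?W \<subseteq> mates M v" using rejected by (auto simp: elements_above_def admits_def)
    then have "card ?W \<le> card (mates M v)" by (rule card_mono[OF fin])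
    then show ?thesis using unfilled by simp
  next
    case replaceable
    have "u \<in> mates M v - {w'}" if u: "u \<in> S" "w \<prec>\<^bsub>v\<^esub> u" for u
    proof -
      have "w' \<prec>\<^bsub>v\<^esub> u" using replaceable(2) u less_pref_trans[OF v] by blast
      then show ?thesis
        using u rejected[of u] replaceable(1) less_pref_irrefl[OF v] by (auto simp: admits_def)
    qed
    then have "card ?W \<le> card (mates M v - {w'})"
      using fin by (intro card_mono) (auto simp: elements_above_def)
    also have "\<dots> < card (mates M v)" by (rule card_Diff1_less[OF fin replaceable(1)])
    also have "\<dots> \<le> quota I v" by (rule assignment_card[OF M v])
    finally show ?thesis .
  qed
qed

lemma quota_le_card_elements_above:
  assumes M: "assignment I M" and v: "v \<in> vertices" and w: "w \<in> mates (edges I) v"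
    and S: "mates M v \<subseteq> S" "finite S"
    and rejected: "w \<notin> mates M v" "\<not> admits M v w"
  shows "quota I v \<le> card (elements_above (pref_less I v) S w)"
proof -
  have "mates M v \<subseteq> elements_above (pref_less I v) S w"
    using not_admitsD(2)[OF M v w rejected(2)] rejected(1) S(1) by (auto simp: elements_above_def)
  then have "card (mates M v) \<le> card (elements_above (pref_less I v) S w)"
    using S(2) by (intro card_mono) (auto simp: elements_above_def)
  then show ?thesis using not_admitsD(1)[OF M v w rejected(2)] by simp
qed

lemma surplus_offers_iff:
  assumes F: "F \<subseteq> edges I" and M: "stable_in F M" and v: "v \<in> agents I Z" and w: "w \<in> mates F v"
  shows "{v, w} \<in> surplus Z (offers (opposite Z) F M) \<longleftrightarrow> w \<notin> mates M v \<and> \<not> admits M v w"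
proof -
  let ?E = "offers (opposite Z) F M"
  have M_assignment: "assignment I M" using M by (simp add: stable_in_def)
  note opposite = mem_mates_offers_opposite[OF F v, of _ M]
  have side: "v \<in> vertices" "w \<in> mates (edges I) v" "w \<in> agents I (opposite Z)"
    using v w agents_subset_vertices mates_mono[OF F] mates_subset_agents[OF v F] by blast+
  have mates: "mates M v \<subseteq> mates ?E v" "finite (mates ?E v)"
    using opposite finite_subset[of "mates ?E v" "mates F v \<union> mates M v"]
      finite_mates[OF F] assignment_finite_mates[OF M_assignment] mates_mono[of M ?E v]
    by (auto simp: offers_def)
  have "\<not> admits M v u" if "u \<in> mates ?E v - mates M v" for u
    using opposite[OF that] that M unblockedD[of F M u v] by (auto simp: stable_in_def)
  then have "quota I v \<le> card (elements_above (pref_less I v) (mates ?E v) w) \<longleftrightarrow>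
      \<not> (w \<in> mates M v \<or> admits M v w)"
    using card_elements_above_less_quota[OF M_assignment side(1) mates(2)]
      quota_le_card_elements_above[OF M_assignment side(1,2) mates] by (metis leD)
  then show ?thesis using surplus_iff[OF v side(3)] by simp
qed

lemma Diff_surplus_offers:
  assumes F: "F \<subseteq> edges I" and M: "stable_in F M"
  shows "F - surplus Z (offers (opposite Z) F M) = offers Z F M"
proof (rule set_eqI)
  fix e
  have M_subset: "M \<subseteq> F" using M by (simp add: stable_in_def)
  show "e \<in> F - surplus Z (offers (opposite Z) F M) \<longleftrightarrow> e \<in> offers Z F M"
  proof (cases "e \<in> F")
    case True
    then obtain v w where e: "e = {v, w}" "v \<in> agents I Z" using edge_agents[of e Z] F by blast
    then have w: "w \<in> mates F v" using True by (simp add: mem_mates_iff)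
    then have "e \<in> offers Z F M \<longleftrightarrow> w \<in> mates M v \<or> admits M v w"
      using mates_offers[OF M_subset F e(2)] e(1) by (auto simp: mem_mates_iff[symmetric])
    then show ?thesis using True surplus_offers_iff[OF F M e(2) w] e(1) by simp
  next
    case False
    then show ?thesis using M_subset by (auto simp: offers_def mem_mates_iff)
  qed
qed

lemma offer_step_offers:
  assumes F: "F \<subseteq> edges I" and M: "stable_in F M"
  shows "offer_step Y F (offers (opposite Y) F M) = offers (opposite Y) F M"
proof -
  have "offers (opposite Y) F M \<inter> F = offers (opposite Y) F M"
    using Diff_surplus_offers[OF F M, of "opposite Y"] by blast
  then show ?thesis
    using Diff_surplus_offers[OF F M, of Y] Diff_surplus_offers[OF F M, of "opposite Y"]
    by (simp add: offer_step_def)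
qed

lemma mates_Diff_surplus:
  assumes E: "E \<subseteq> edges I" and v: "v \<in> agents I Z"
  shows "card (mates (E - surplus Z E) v) \<le> quota I v"
    and "\<lbrakk>w \<in> mates (edges I) v; {v, w} \<in> surplus Z E\<rbrakk> \<Longrightarrow> \<not> admits (E - surplus Z E) v w"
proof -
  have v_vertex: "v \<in> vertices" using v agents_subset_vertices by blast
  have side: "mates (edges I) v \<subseteq> agents I (opposite Z)" using mates_subset_agents[OF v] by simp
  have mates: "finite (mates E v)" "mates E v \<subseteq> mates (edges I) v"
    using finite_mates[OF E] mates_mono[OF E] .
  have top: "mates (E - surplus Z E) v = top_elements (pref_less I v) (quota I v) (mates E v)"
  proof -
    have "{v, w} \<in> surplus Z E \<longleftrightarrow>
        quota I v \<le> card (elements_above (pref_less I v) (mates E v) w)"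
      if "w \<in> mates E v" for w
      using surplus_iff[OF v] side mates(2) that by blast
    then show ?thesis
      by (auto simp: top_elements_def mates_Diff mem_mates_iff[of _ "surplus Z E"])
  qed
  show "card (mates (E - surplus Z E) v) \<le> quota I v"
    unfolding top by (rule card_top_elements_le[OF pref_linear[OF v_vertex] mates])
  assume w: "w \<in> mates (edges I) v" "{v, w} \<in> surplus Z E"
  then have "quota I v \<le> card (elements_above (pref_less I v) (mates E v) w)"
    using surplus_iff[OF v] side by blast
  note surpassed =
    card_top_elements_if_surpassed[OF pref_linear[OF v_vertex] mates w(1) this, folded top]
  show "\<not> admits (E - surplus Z E) v w"
    unfolding admits_def using surpassed less_pref_asym[OF v_vertex] by (metis less_irrefl)
qed

lemma assignment_Diff_surplus:
  assumes "D \<subseteq> edges I" "E \<subseteq> edges I"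
    and dual: "E - surplus Y E = D - surplus (opposite Y) D"
  shows "assignment I (E - surplus Y E)"
  unfolding assignment_iff
proof (intro conjI ballI)
  fix v assume "v \<in> vertices"
  then consider (own) "v \<in> agents I Y" | (opposite) "v \<in> agents I (opposite Y)"
    using vertices_eq_agents by blast
  then show "card (mates (E - surplus Y E) v) \<le> quota I v"
  proof cases
    case own
    then show ?thesis by (rule mates_Diff_surplus(1)[OF assms(2)])
  next
    case opposite
    then show ?thesis unfolding dual by (rule mates_Diff_surplus(1)[OF assms(1)])
  qed
qed (use assms(2) in blast)

lemma offer_step_fixpoint_stable_in:
  assumes F: "F \<subseteq> edges I" and fixpoint: "offer_step Y F E = E"
  shows "stable_in F (E - surplus Y E)"
proof -
  let ?M = "E - surplus Y E" and ?D = "F - surplus Y E"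
  have E_subset: "E \<subseteq> F" using fixpoint by (auto simp: offer_step_def)
  then have E: "E = F - surplus (opposite Y) ?D"
    using fixpoint by (simp add: offer_step_def Int_absorb2)
  have dual: "?M = ?D - surplus (opposite Y) ?D" using E by blast
  have edges: "E \<subseteq> edges I" "?D \<subseteq> edges I" using E_subset F by auto
  have "unblocked F ?M"
  proof (rule unblockedI_side[OF F])
    fix x y assume x: "x \<in> agents I Y" and y: "y \<in> mates F x - mates ?M x"
    have y_side: "y \<in> agents I (opposite Y)" using mates_subset_agents[OF x F] y by blast
    have mates: "y \<in> mates (edges I) x" "x \<in> mates (edges I) y"
      using y mates_mono[OF F] mates_commute[of x _ y] by blast+
    have edge: "{x, y} \<in> F" "{x, y} \<notin> ?M" "{y, x} = {x, y}"
      using y by (auto simp: mem_mates_iff)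
    show "\<not> (admits ?M x y \<and> admits ?M y x)"
    proof (cases "{x, y} \<in> surplus Y E")
      case True
      then show ?thesis using mates_Diff_surplus(2)[OF edges(1) x mates(1)] by blast
    next
      case False
      then have "{y, x} \<in> surplus (opposite Y) ?D" using edge E by auto
      then show ?thesis using mates_Diff_surplus(2)[OF edges(2) y_side mates(2)] dual by auto
    qed
  qed
  then show ?thesis
    using E_subset assignment_Diff_surplus[OF edges(2,1) dual] by (auto simp: stable_in_def)
qed

lemma ex_optimal_stable_in:
  assumes F: "F \<subseteq> edges I"
  shows "\<exists>M. stable_in F M \<and> (\<forall>N. stable_in F N \<longrightarrow> (\<forall>y \<in> agents I Y. \<not> favours N M y))"
proof -
  define E where "E = gfp (offer_step Y F)"
  let ?M = "E - surplus Y E"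
  have fixpoint: "offer_step Y F E = E"
    using gfp_unfold[OF mono_offer_step[OF F]] by (simp add: E_def)
  then have M: "stable_in F ?M" by (rule offer_step_fixpoint_stable_in[OF F])
  moreover have "\<not> favours N ?M y" if N: "stable_in F N" and y: "y \<in> agents I Y" for N y
  proof
    assume favours: "favours N ?M y"
    note compat = stable_in_compatible[OF N M]
    have "offers (opposite Y) F N \<subseteq> E"
      unfolding E_def by (rule gfp_upperbound) (simp add: offer_step_offers[OF F N])
    then have NE: "N \<subseteq> E" by (auto simp: offers_def)
    have E: "E \<subseteq> edges I" using fixpoint F by (auto simp: offer_step_def)
    obtain w where w: "w \<in> mates N y - mates ?M y"
      using favours_Diff_nonempty[OF compat favours] by blast
    then have "{y, w} \<in> surplus Y E" using NE by (auto simp: mem_mates_iff)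
    moreover have "w \<in> mates (edges I) y" using w mates_mono[OF compatibleD(3)[OF compat]] by blast
    ultimately have "\<not> admits ?M y w" using mates_Diff_surplus(2)[OF E y] by blast
    then have "favours ?M N y" using w by (auto simp: favours_def)
    then show False using favours favours_asym compatibleD[OF compat] by blast
  qed
  ultimately show ?thesis by blast
qed

section \<open>Candidates\<close>

definition candidates :: "'v set set \<Rightarrow> 'v set set \<Rightarrow> 'v \<Rightarrow> 'v set" where
  "candidates F M x = {y \<in> mates F x - mates M x. \<exists>x' \<in> mates M y. x' \<prec>\<^bsub>y\<^esub> x}"

definition greatest_at :: "'v \<Rightarrow> 'v set \<Rightarrow> 'v \<Rightarrow> bool" where
  "greatest_at v S y \<longleftrightarrow> y \<in> S \<and> (\<forall>y' \<in> S. y' = y \<or> y' \<prec>\<^bsub>v\<^esub> y)"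

definition least_at :: "'v \<Rightarrow> 'v set \<Rightarrow> 'v \<Rightarrow> bool" where
  "least_at v S x \<longleftrightarrow> x \<in> S \<and> (\<forall>x' \<in> S. x' = x \<or> x \<prec>\<^bsub>v\<^esub> x')"

lemma candidates_mono: "F \<subseteq> F' \<Longrightarrow> candidates F M x \<subseteq> candidates F' M x"
  using mates_mono[of F F' x] by (auto simp: candidates_def)

lemma candidates_subset_mates: "candidates F M x \<subseteq> mates F x"
  by (auto simp: candidates_def)

lemma ex1_greatest_at:
  assumes "v \<in> vertices" "S \<subseteq> mates (edges I) v" "S \<noteq> {}"
  shows "\<exists>!y. greatest_at v S y"
proof -
  have "finite S" using assms(2) finite_mates[of "edges I" v] finite_subset by blast
  then have "\<exists>y. greatest_at v S y"
    using ex_greatest_of_strict_linear_order[OF pref_linear] assms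
    unfolding greatest_at_def by metis
  then show ?thesis
    using less_pref_asym[OF assms(1)] unfolding greatest_at_def by metis
qed

lemma ex1_least_at:
  assumes "v \<in> vertices" "S \<subseteq> mates (edges I) v" "S \<noteq> {}"
  shows "\<exists>!x. least_at v S x"
proof -
  have "finite S" using assms(2) finite_mates[of "edges I" v] finite_subset by blast
  then have "\<exists>x. least_at v S x"
    using ex_least_of_strict_linear_order[OF pref_linear] assms unfolding least_at_def by metis
  then show ?thesis
    using less_pref_asym[OF assms(1)] unfolding least_at_def by metis
qed

lemma candidates_compatible:
  assumes "compatible M N"
  shows "candidates N M x = (if favours M N x then mates N x - mates M x else {})"
proof -
  have "(\<exists>x' \<in> mates M y. x' \<prec>\<^bsub>y\<^esub> x) \<longleftrightarrow> favours M N x" if y: "y \<in> mates N x - mates M x" for y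
  proof
    have xy: "x \<in> mates N y - mates M y" using y mates_commute[of y _ x] by simp
    assume "\<exists>x' \<in> mates M y. x' \<prec>\<^bsub>y\<^esub> x"
    then have "\<not> favours M N y" using favours_not_admits[OF assms _ xy] by (auto simp: admits_def)
    then show "favours M N x" using compatible_polarized[OF assms y] by blast
  next
    assume "favours M N x"
    then have favours: "favours N M y"
      using compatible_favours_iff[OF compatible_sym[OF assms], of y x] y by blast
    then obtain x' where "x' \<in> mates M y - mates N y" by (auto simp: favours_def)
    then show "\<exists>x' \<in> mates M y. x' \<prec>\<^bsub>y\<^esub> x"
      using favours_less_pref[OF compatible_sym[OF assms] favours] y mates_commute[of y N x]
      by blast
  qed
  then show ?thesis unfolding candidates_def by auto
qed

lemma candidates_compatible_eq_empty_iff: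
  "compatible M N \<Longrightarrow> candidates N M x = {} \<longleftrightarrow> \<not> favours M N x"
  by (auto simp: candidates_compatible favours_def)

lemma favours_if_replaced:
  assumes compat: "compatible M N" and least: "least_at y (mates M y) x"
    and x': "x' \<in> mates N y - mates M y" "x \<prec>\<^bsub>y\<^esub> x'"
  shows "favours M N x"
proof -
  have y: "y \<in> vertices" using x'(1) mates_vertices(1)[OF compatibleD(4)[OF compat]] by blast
  have "admits M y x'" using least x'(2) by (auto simp: least_at_def admits_def)
  then have "\<not> favours M N y" using favours_not_admits[OF compat _ x'(1)] by blast
  then have favours: "favours N M y" using compatible_favours_cases[OF compat] x'(1) by blast
  then obtain z where z: "z \<in> mates M y - mates N y" by (auto simp: favours_def)
  have "x \<notin> mates N y"
  proof
    assume "x \<in> mates N y"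
    then have "z \<prec>\<^bsub>y\<^esub> x" using favours_less_pref[OF compatible_sym[OF compat] favours z] by blast
    moreover have "z = x \<or> x \<prec>\<^bsub>y\<^esub> z" using least z by (auto simp: least_at_def)
    ultimately show False using less_pref_asym[OF y] less_pref_irrefl[OF y] by blast
  qed
  then show ?thesis
    using compatible_favours_iff[OF compat, of x y] least favours by (auto simp: least_at_def)
qed

section \<open>The rotation digraph\<close>

definition succ_agent :: "'v set set \<Rightarrow> 'v set set \<Rightarrow> 'v \<Rightarrow> 'v" where
  "succ_agent F M x = (THE y. greatest_at x (candidates F M x) y)"

definition worst_mate :: "'v set set \<Rightarrow> 'v \<Rightarrow> 'v" where
  "worst_mate M y = (THE x. least_at y (mates M y) x)"

abbreviation next_agent :: "'v set set \<Rightarrow> 'v set set \<Rightarrow> 'v \<Rightarrow> 'v" where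
  "next_agent F M x \<equiv> worst_mate M (succ_agent F M x)"

definition full :: "'v set set \<Rightarrow> 'v \<Rightarrow> bool" where
  "full M y \<longleftrightarrow> card (mates M y) = quota I y"

definition removable :: "'v set set \<Rightarrow> 'v set set \<Rightarrow> 'v \<Rightarrow> bool" where
  "removable F M x \<longleftrightarrow> candidates F M x \<noteq> {} \<and>
     (full M (succ_agent F M x) \<longrightarrow> candidates F M (next_agent F M x) = {})"

lemma restrict_edges_simps [simp]:
  "students (restrict_edges I F) = students I" "schools (restrict_edges I F) = schools I"
  "quota (restrict_edges I F) = quota I" "edges (restrict_edges I F) = F"
  "pref_less (restrict_edges I F) v = pref_less I v \<inter> (mates F v \<times> mates F v)"
  by (auto simp: restrict_edges_def)

lemma agents_restrict_edges [simp]: "agents (restrict_edges I F) X = agents I X"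
  by (cases X) auto

context
  fixes F M :: "'v set set"
  assumes F: "F \<subseteq> edges I" and M: "M \<subseteq> F"
begin

lemma greatest_at_succ_agent:
  assumes "candidates F M x \<noteq> {}"
  shows "greatest_at x (candidates F M x) (succ_agent F M x)"
proof -
  have cand_subset: "candidates F M x \<subseteq> mates (edges I) x"
    using candidates_subset_mates mates_mono[OF F] by blast
  then have "x \<in> vertices" using assms mates_vertices(1)[OF order_refl] by blast
  then show ?thesis
    unfolding succ_agent_def by (rule theI'[OF ex1_greatest_at[OF _ cand_subset assms]])
qed

lemma least_at_worst_mate:
  assumes "mates M y \<noteq> {}"
  shows "least_at y (mates M y) (worst_mate M y)"
proof -
  have mates_subset: "mates M y \<subseteq> mates (edges I) y" using mates_mono[OF order_trans[OF M F]] .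
  then have "y \<in> vertices" using assms mates_vertices(1)[OF order_refl] by blast
  then show ?thesis
    unfolding worst_mate_def by (rule theI'[OF ex1_least_at[OF _ mates_subset assms]])
qed

lemma succ_agent_candidate:
  assumes "candidates F M x \<noteq> {}"
  shows "succ_agent F M x \<in> mates F x" "succ_agent F M x \<notin> mates M x"
    "mates M (succ_agent F M x) \<noteq> {}"
  using greatest_at_succ_agent[OF assms] by (auto simp: greatest_at_def candidates_def)

lemma least_at_next_agent:
  "candidates F M x \<noteq> {} \<Longrightarrow>
    least_at (succ_agent F M x) (mates M (succ_agent F M x)) (next_agent F M x)"
  by (intro least_at_worst_mate succ_agent_candidate(3))

lemma succ_agent_opposite:
  "x \<in> agents I X \<Longrightarrow> candidates F M x \<noteq> {} \<Longrightarrow> succ_agent F M x \<in> agents I (opposite X)"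
  using mates_subset_agents[OF _ F] succ_agent_candidate(1) by blast

lemma next_agent_same_side:
  assumes "x \<in> agents I X" "candidates F M x \<noteq> {}"
  shows "next_agent F M x \<in> agents I X"
  using mates_subset_agents[OF succ_agent_opposite[OF assms], of M] M F
    least_at_next_agent[OF assms(2)]
  by (auto simp: least_at_def)

lemma next_agent_less_pref:
  assumes "candidates F M x \<noteq> {}"
  shows "next_agent F M x \<prec>\<^bsub>succ_agent F M x\<^esub> x"
proof -
  let ?y = "succ_agent F M x"
  have y: "?y \<in> vertices" using mates_vertices(2)[OF F] succ_agent_candidate(1)[OF assms] .
  obtain x' where "x' \<in> mates M ?y" "x' \<prec>\<^bsub>?y\<^esub> x"
    using greatest_at_succ_agent[OF assms] by (auto simp: greatest_at_def candidates_def)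
  moreover from this have "next_agent F M x = x' \<or> next_agent F M x \<prec>\<^bsub>?y\<^esub> x'"
    using least_at_next_agent[OF assms] by (auto simp: least_at_def)
  ultimately show ?thesis using less_pref_trans[OF y] by blast
qed

lemma rot_succ_restrict_edges:
  "rot_succ (restrict_edges I F) M x =
    (if candidates F M x = {} then None else Some (succ_agent F M x))"
proof -
  have "x \<in> mates F y" if "y \<in> mates F x" for y using that mates_commute by metis
  then have cand: "succ_candidates (restrict_edges I F) M x = candidates F M x"
    using mates_mono[OF M] unfolding succ_candidates_def candidates_def by fastforce
  moreover have "y \<in> candidates F M x \<and>
      (\<forall>y' \<in> candidates F M x. y' = y \<or> (y', y) \<in> pref_less (restrict_edges I F) x) \<longleftrightarrow>
      greatest_at x (candidates F M x) y" for y
    by (auto simp: greatest_at_def candidates_def)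
  ultimately show ?thesis by (simp add: rot_succ_def succ_agent_def)
qed

lemma rot_next_restrict_edges:
  assumes "candidates F M x \<noteq> {}"
  shows "rot_next (restrict_edges I F) M x =
    (if full M (succ_agent F M x) then Some (next_agent F M x) else None)"
proof -
  have "z \<in> mates M y \<and> (\<forall>z' \<in> mates M y. z' = z \<or> (z, z') \<in> pref_less (restrict_edges I F) y) \<longleftrightarrow>
      least_at y (mates M y) z" for y z
    using mates_mono[OF M, of y] by (auto simp: least_at_def)
  then show ?thesis
    using assms by (simp add: rot_next_def rot_succ_restrict_edges worst_mate_def full_def)
qed

lemma arc_from_agent:
  assumes "x \<in> agents I X"
  shows "(Some x, v) \<in> parcs (rotation_digraph (restrict_edges I F) X M) \<longleftrightarrow>
    candidates F M x \<noteq> {} \<and> v = Some (succ_agent F M x)"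
  using assms agents_disjoint[of X] succ_agent_opposite
  by (auto simp: rotation_digraph_def rot_succ_restrict_edges)

lemma arc_from_opposite_agent:
  assumes "y \<in> agents I (opposite X)"
  shows "(Some y, v) \<in> parcs (rotation_digraph (restrict_edges I F) X M) \<longleftrightarrow>
    (\<exists>x \<in> agents I X. candidates F M x \<noteq> {} \<and> succ_agent F M x = y) \<and>
    v = (if full M y then Some (worst_mate M y) else None)"
  using assms agents_disjoint[of X]
  by (auto simp: rotation_digraph_def rot_succ_restrict_edges rot_next_restrict_edges)

lemma no_arcs_iff:
  "parcs (rotation_digraph (restrict_edges I F) X M) = {} \<longleftrightarrow>
    (\<forall>x \<in> agents I X. candidates F M x = {})"
  by (auto simp: rotation_digraph_def rot_succ_restrict_edges)

lemma is_sink_agent_iff: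
  assumes "x \<in> agents I X"
  shows "is_sink (rotation_digraph (restrict_edges I F) X M) (Some x) \<longleftrightarrow> candidates F M x = {}"
proof -
  have "Some x \<in> pverts (rotation_digraph (restrict_edges I F) X M)"
    using assms agents_subset_vertices[of X] by (auto simp: rotation_digraph_def)
  then show ?thesis
    using arc_from_agent[OF assms] by (auto simp: is_sink_def out_arcs_def)
qed

lemma removable_iff:
  assumes "x' \<in> agents I X"
  defines "D \<equiv> rotation_digraph (restrict_edges I F) X M"
  shows "(Some x', Some y) \<in> parcs D \<and> (\<exists>x. (Some y, x) \<in> parcs D \<and> is_sink D x) \<longleftrightarrow>
    removable F M x' \<and> y = succ_agent F M x'"
proof (cases "candidates F M x' = {}")
  case True
  then show ?thesis using arc_from_agent[OF assms(1)] by (simp add: D_def removable_def)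
next
  case False
  let ?y = "succ_agent F M x'"
  have "(Some ?y, x) \<in> parcs D \<longleftrightarrow> x = (if full M ?y then Some (worst_mate M ?y) else None)" for x
    using arc_from_opposite_agent[OF succ_agent_opposite[OF assms(1) False]] assms(1) False
    by (auto simp: D_def)
  moreover have "is_sink D (Some (worst_mate M ?y)) \<longleftrightarrow> candidates F M (worst_mate M ?y) = {}"
    using is_sink_agent_iff next_agent_same_side[OF assms(1) False] by (simp add: D_def)
  moreover have "is_sink D None"
    by (auto simp: D_def is_sink_def out_arcs_def rotation_digraph_def)
  ultimately show ?thesis
    using False arc_from_agent[OF assms(1)] by (auto simp: D_def removable_def)
qed

end

end

section \<open>Cycles of the rotation digraph\<close>

lemma zip_rotate1_conv_nth:
  "zip xs (rotate1 xs) = map (\<lambda>i. (xs ! i, xs ! (Suc i mod length xs))) [0..<length xs]"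
  by (rule nth_equalityI) (simp_all add: nth_rotate1)

lemma rotation_arcs_conv_zip:
  "rotation_arcs \<rho> = concat (map
    (\<lambda>(p, q). [(Some (fst p), Some (snd p)), (Some (snd p), Some (fst q))]) (zip \<rho> (rotate1 \<rho>)))"
  by (simp add: rotation_arcs_def zip_rotate1_conv_nth comp_def)

lemma image_fst_zip_rotate1: "f ` set xs = (\<lambda>z. f (fst z)) ` set (zip xs (rotate1 xs))"
proof -
  have "fst ` set (zip xs (rotate1 xs)) = set xs" by (metis length_rotate1 map_fst_zip set_map)
  then show ?thesis by (metis image_image)
qed

lemma image_snd_zip_rotate1: "f ` set xs = (\<lambda>z. f (snd z)) ` set (zip xs (rotate1 xs))"
proof -
  have "snd ` set (zip xs (rotate1 xs)) = set xs"
    by (metis length_rotate1 map_snd_zip set_map set_rotate1)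
  then show ?thesis by (metis image_image)
qed

lemma set_rotation_arcs:
  "set (rotation_arcs \<rho>) = (\<lambda>p. (Some (fst p), Some (snd p))) ` set \<rho> \<union>
    (\<lambda>(p, q). (Some (snd p), Some (fst q))) ` set (zip \<rho> (rotate1 \<rho>))"
  unfolding image_fst_zip_rotate1[of _ \<rho>] by (force simp: rotation_arcs_conv_zip)

lemma mset_concat_pairs:
  "length xs = length ys \<Longrightarrow>
    mset (concat (map (\<lambda>(p, q). [f p, g q]) (zip xs ys))) = mset (map f xs @ map g ys)"
  by (induction xs ys rule: list_induct2) auto

lemma distinct_heads_rotation_arcs:
  assumes "fst ` set \<rho> \<inter> snd ` set \<rho> = {}"
  shows "distinct (map snd (rotation_arcs \<rho>)) \<longleftrightarrow> distinct (map fst \<rho>) \<and> distinct (map snd \<rho>)"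
proof -
  have "map snd (rotation_arcs \<rho>) =
      concat (map (\<lambda>(p, q). [Some (snd p), Some (fst q)]) (zip \<rho> (rotate1 \<rho>)))"
    by (simp add: rotation_arcs_conv_zip map_concat comp_def case_prod_unfold)
  then have "mset (map snd (rotation_arcs \<rho>)) =
      mset (map Some (map snd \<rho>) @ map Some (map fst (rotate1 \<rho>)))"
    using mset_concat_pairs[of \<rho> "rotate1 \<rho>" "Some \<circ> snd" "Some \<circ> fst"] by (simp add: comp_def)
  from mset_eq_imp_distinct_iff[OF this] show ?thesis
    using assms by (auto simp: rotate1_map[symmetric] distinct_map inj_on_def)
qed

lemma cycle_rotation_arcs_iff:
  assumes "\<rho> \<noteq> []"
  shows "pre_digraph.cycle (with_proj D) (rotation_arcs \<rho>) \<longleftrightarrow>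
    Some (fst (hd \<rho>)) \<in> pverts D \<and> set (rotation_arcs \<rho>) \<subseteq> parcs D \<and>
    distinct (map snd (rotation_arcs \<rho>))"
proof -
  obtain p ps where \<rho>: "\<rho> = p # ps" using assms by (cases \<rho>) auto
  obtain q qs where rotate1: "rotate1 \<rho> = q # qs" using \<rho> by (cases "rotate1 \<rho>") auto
  let ?arcs = "\<lambda>(p, q). [(Some (fst p), Some (snd p)), (Some (snd p), Some (fst q))]"
  have "pcas (Some (fst p)) (concat (map ?arcs (zip (p # ps) (ps @ [q])))) (Some (fst q))" for q
    by (induction ps arbitrary: p) auto
  then have cas: "pcas (Some (fst p)) (rotation_arcs \<rho>) (Some (fst p))"
    by (simp add: rotation_arcs_conv_zip \<rho>)
  have start: "u = Some (fst p)" if "pcas u (rotation_arcs \<rho>) w" for u w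
    using that rotate1 by (simp add: rotation_arcs_conv_zip \<rho>)
  have verts: "tl (pawalk_verts (Some (fst p)) (rotation_arcs \<rho>)) = map snd (rotation_arcs \<rho>)"
    using pre_digraph.awalk_verts_conv'[of "with_proj D" "Some (fst p)" "rotation_arcs \<rho>"] cas
    by (simp add: cas_with_proj_eq awalk_verts_with_proj_eq)
  have "rotation_arcs \<rho> \<noteq> []" using rotate1 by (simp add: rotation_arcs_conv_zip \<rho>)
  then have "pre_digraph.cycle (with_proj D) (rotation_arcs \<rho>) \<longleftrightarrow> (\<exists>u. u \<in> pverts D \<and>
      set (rotation_arcs \<rho>) \<subseteq> parcs D \<and> pcas u (rotation_arcs \<rho>) u \<and>
      distinct (tl (pawalk_verts u (rotation_arcs \<rho>))))"
    by (simp add: pre_digraph.cycle_def pre_digraph.awalk_def cas_with_proj_eq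
        awalk_verts_with_proj_eq)
  also have "\<dots> \<longleftrightarrow> Some (fst p) \<in> pverts D \<and> set (rotation_arcs \<rho>) \<subseteq> parcs D \<and>
      distinct (map snd (rotation_arcs \<rho>))"
    using cas start verts by metis
  finally show ?thesis by (simp add: \<rho>)
qed


lemma ex_cycle_of_finite_invariant:
  assumes "finite S" "x \<in> S" "f ` S \<subseteq> S"
  shows "\<exists>z n. z \<in> S \<and> 0 < n \<and> (f ^^ n) z = z \<and> inj_on (\<lambda>k. (f ^^ Suc k) z) {0..<n}"
proof -
  have iterates: "(f ^^ k) x \<in> S" for k
    by (induction k) (use assms(2,3) in auto)
  then have "finite (range (\<lambda>k. (f ^^ k) x))" by (intro finite_subset[OF _ assms(1)]) auto
  then have "\<not> inj (\<lambda>k. (f ^^ k) x)" using range_inj_infinite by blast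
  then obtain i j where ij: "i < j" "(f ^^ i) x = (f ^^ j) x"
    unfolding inj_def by (metis linorder_neqE_nat)
  define w where "w = (f ^^ i) x"
  have "w = (f ^^ (j - i)) w" "0 < j - i"
    using ij funpow_add[of "j - i" i f] by (simp_all add: w_def)
  then have orbit: "w \<in> orbit f w" unfolding orbit_altdef by blast
  obtain n where n: "funpow_dist1 f w w = Suc n" by blast
  define z where "z = (f ^^ n) w"
  have fz: "f z = w" using funpow_dist1_prop[OF orbit] by (simp add: n z_def)
  have funpow_Suc_z: "(f ^^ Suc k) z = (f ^^ k) w" for k by (simp only: funpow_Suc_right comp_def fz)
  have "z \<in> S" using iterates[of "n + i"] by (simp add: z_def w_def funpow_add)
  moreover have "(f ^^ Suc n) z = z" using funpow_Suc_z[of n] by (simp only: z_def[symmetric])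
  moreover have "inj_on (\<lambda>k. (f ^^ Suc k) z) {0..<Suc n}"
    unfolding funpow_Suc_z using inj_on_funpow_dist1[OF orbit] by (simp only: n)
  ultimately show ?thesis by blast
qed

context two_sided_market
begin

definition rotation_list :: "'v set set \<Rightarrow> side \<Rightarrow> 'v set set \<Rightarrow> ('v \<times> 'v) list \<Rightarrow> bool" where
  "rotation_list F X M \<rho> \<longleftrightarrow> \<rho> \<noteq> [] \<and> set \<rho> \<subseteq> agents I (opposite X) \<times> agents I X \<and>
     distinct (map fst \<rho>) \<and> distinct (map snd \<rho>) \<and>
     (\<forall>p \<in> set \<rho>. full M (fst p) \<and> worst_mate M (fst p) = snd p) \<and>
     (\<forall>(p, q) \<in> set (zip \<rho> (rotate1 \<rho>)).
        candidates F M (snd p) \<noteq> {} \<and> succ_agent F M (snd p) = fst q)"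

lemma rotation_arcs_subset_iff:
  assumes F: "F \<subseteq> edges I" and M: "M \<subseteq> F"
    and sides: "set \<rho> \<subseteq> agents I (opposite X) \<times> agents I X"
  shows "set (rotation_arcs \<rho>) \<subseteq> parcs (rotation_digraph (restrict_edges I F) X M) \<longleftrightarrow>
    (\<forall>p \<in> set \<rho>. full M (fst p) \<and> worst_mate M (fst p) = snd p) \<and>
    (\<forall>(p, q) \<in> set (zip \<rho> (rotate1 \<rho>)).
      candidates F M (snd p) \<noteq> {} \<and> succ_agent F M (snd p) = fst q)"
proof -
  let ?D = "rotation_digraph (restrict_edges I F) X M"
  let ?Z = "set (zip \<rho> (rotate1 \<rho>))"
  have zip_sides: "snd p \<in> agents I X" "fst q \<in> agents I (opposite X)" if "(p, q) \<in> ?Z" for p q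
    using set_zip_leftD[OF that] set_zip_rightD[OF that] sides by (auto simp: mem_Times_iff)
  have succs: "(Some (snd p), Some (fst q)) \<in> parcs ?D \<longleftrightarrow>
      candidates F M (snd p) \<noteq> {} \<and> succ_agent F M (snd p) = fst q" if "(p, q) \<in> ?Z" for p q
    unfolding arc_from_agent[OF F M zip_sides(1)[OF that]] by (simp add: eq_commute)
  have worsts: "(Some (fst q), Some (snd q)) \<in> parcs ?D \<longleftrightarrow>
      full M (fst q) \<and> worst_mate M (fst q) = snd q"
    if "(p, q) \<in> ?Z" "candidates F M (snd p) \<noteq> {}" "succ_agent F M (snd p) = fst q" for p q
    unfolding arc_from_opposite_agent[OF F M zip_sides(2)[OF that(1)]]
    using zip_sides(1)[OF that(1)] that(2,3) by auto
  have ball_set_iff: "(\<forall>q \<in> set \<rho>. P q) \<longleftrightarrow> (\<forall>(p, q) \<in> ?Z. P q)" for P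
    using image_snd_zip_rotate1[of "\<lambda>q. q" \<rho>] by (auto simp: case_prod_unfold)
  have "set (rotation_arcs \<rho>) \<subseteq> parcs ?D \<longleftrightarrow> (\<forall>(p, q) \<in> ?Z.
      (Some (fst q), Some (snd q)) \<in> parcs ?D \<and> (Some (snd p), Some (fst q)) \<in> parcs ?D)"
    using ball_set_iff[of "\<lambda>q. (Some (fst q), Some (snd q)) \<in> parcs ?D"]
    unfolding set_rotation_arcs by auto
  also have "\<dots> \<longleftrightarrow> (\<forall>(p, q) \<in> ?Z. (full M (fst q) \<and> worst_mate M (fst q) = snd q) \<and>
      (candidates F M (snd p) \<noteq> {} \<and> succ_agent F M (snd p) = fst q))"
    by (rule ball_cong[OF refl], unfold case_prod_unfold) (metis prod.collapse succs worsts)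
  also have "\<dots> \<longleftrightarrow> (\<forall>q \<in> set \<rho>. full M (fst q) \<and> worst_mate M (fst q) = snd q) \<and>
      (\<forall>(p, q) \<in> ?Z. candidates F M (snd p) \<noteq> {} \<and> succ_agent F M (snd p) = fst q)"
    using ball_set_iff[of "\<lambda>q. full M (fst q) \<and> worst_mate M (fst q) = snd q"] by auto
  finally show ?thesis .
qed

lemma is_rotation_iff:
  assumes F: "F \<subseteq> edges I" and M: "M \<subseteq> F"
  shows "is_rotation (restrict_edges I F) X M \<rho> \<longleftrightarrow> rotation_list F X M \<rho>"
proof (cases "\<rho> \<noteq> [] \<and> set \<rho> \<subseteq> agents I (opposite X) \<times> agents I X")
  case False
  then show ?thesis
    by (auto simp: is_rotation_def rotation_list_def rotation_arcs_def pre_digraph.cycle_def)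
next
  case True
  then have "fst ` set \<rho> \<subseteq> agents I (opposite X)" "snd ` set \<rho> \<subseteq> agents I X"
    by (auto simp: mem_Times_iff)
  then have "fst ` set \<rho> \<inter> snd ` set \<rho> = {}" using agents_disjoint[of X] by blast
  note heads = distinct_heads_rotation_arcs[OF this]
  have "fst (hd \<rho>) \<in> agents I (opposite X)" using True by (cases \<rho>) auto
  then have "Some (fst (hd \<rho>)) \<in> pverts (rotation_digraph (restrict_edges I F) X M)"
    using agents_subset_vertices[of "opposite X"] by (auto simp: rotation_digraph_def)
  then show ?thesis
    using True unfolding is_rotation_def rotation_list_def
    by (auto simp: cycle_rotation_arcs_iff heads rotation_arcs_subset_iff[OF F M])
qed

lemma ex_rotation_list:
  assumes F: "F \<subseteq> edges I" and M: "M \<subseteq> F"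
    and x: "x \<in> agents I X" "candidates F M x \<noteq> {}"
    and none: "\<And>x. x \<in> agents I X \<Longrightarrow> \<not> removable F M x"
  shows "\<exists>\<rho>. rotation_list F X M \<rho>"
proof -
  let ?S = "{x \<in> agents I X. candidates F M x \<noteq> {}}" and ?f = "next_agent F M"
  have next_in_S: "full M (succ_agent F M x) \<and> ?f x \<in> ?S" if "x \<in> ?S" for x
    using that none[of x] next_agent_same_side[OF F M] by (auto simp: removable_def)
  then have "?f ` ?S \<subseteq> ?S" by blast
  moreover have "finite ?S" "x \<in> ?S" using finite_agents x by auto
  ultimately obtain z n where z: "z \<in> ?S" "0 < n" "(?f ^^ n) z = z"
      and inj: "inj_on (\<lambda>k. (?f ^^ Suc k) z) {0..<n}"
    using ex_cycle_of_finite_invariant[of ?S x ?f] by blast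
  have in_S: "(?f ^^ k) z \<in> ?S" for k by (induction k) (use z next_in_S in auto)
  define \<rho> where "\<rho> = map (\<lambda>k. (succ_agent F M ((?f ^^ k) z), (?f ^^ Suc k) z)) [0..<n]"
  have "inj_on (\<lambda>k. succ_agent F M ((?f ^^ k) z)) {0..<n}"
    using inj by (auto simp: inj_on_def)
  then have "distinct (map fst \<rho>) \<and> distinct (map snd \<rho>)"
    using inj by (simp add: \<rho>_def distinct_map comp_def)
  moreover have "set \<rho> \<subseteq> agents I (opposite X) \<times> agents I X"
    using in_S in_S[of "Suc _"] succ_agent_opposite[OF F M] by (auto simp: \<rho>_def)
  moreover have "\<forall>p \<in> set \<rho>. full M (fst p) \<and> worst_mate M (fst p) = snd p"
    using next_in_S in_S by (auto simp: \<rho>_def)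
  moreover have "\<forall>(p, q) \<in> set (zip \<rho> (rotate1 \<rho>)).
      candidates F M (snd p) \<noteq> {} \<and> succ_agent F M (snd p) = fst q"
    using in_S[of "Suc _"] funpow_mod_eq[OF z(3), of "Suc _"]
    by (auto simp: zip_rotate1_conv_nth \<rho>_def simp del: funpow.simps)
  ultimately have "rotation_list F X M \<rho>" using z(2) by (simp add: rotation_list_def \<rho>_def)
  then show ?thesis by blast
qed

end

section \<open>Eliminating a rotation\<close>

text \<open>A rotation \<open>y\<^sub>0, x\<^sub>0, y\<^sub>1, x\<^sub>1, \<dots>\<close> is represented by the set \<open>C\<close> of its agents \<open>x\<^sub>i\<close>, since
  \<open>s\<^sub>M(x\<^sub>i) = y\<^sub>i\<^sub>+\<^sub>1\<close> and \<open>next\<^sub>M(x\<^sub>i) = x\<^sub>i\<^sub>+\<^sub>1\<close>. That \<open>next\<^sub>M\<close> permutes \<open>C\<close> suffices, so \<open>C\<close> may also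
  combine several disjoint rotations.\<close>

locale rotation = two_sided_market I for I :: "'v sa_instance" +
  fixes F :: "'v set set" and X :: side and M :: "'v set set" and C :: "'v set"
  assumes F_subset: "F \<subseteq> edges I" and M_subset: "M \<subseteq> F"
    and movers_side: "C \<subseteq> agents I X" and movers_nonempty: "C \<noteq> {}"
    and movers_permuted: "next_agent F M ` C = C"
    and movers_candidates: "x \<in> C \<Longrightarrow> candidates F M x \<noteq> {}"
    and movers_full: "x \<in> C \<Longrightarrow> full M (succ_agent F M x)"
begin

abbreviation s :: "'v \<Rightarrow> 'v" where
  "s \<equiv> succ_agent F M"

abbreviation nxt :: "'v \<Rightarrow> 'v" where
  "nxt \<equiv> next_agent F M"

definition rotated :: "'v set set" where
  "rotated = (M - (\<lambda>x. {nxt x, s x}) ` C) \<union> (\<lambda>x. {x, s x}) ` C"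

lemma M_edges: "M \<subseteq> edges I"
  using M_subset F_subset by blast

lemma inj_on_nxt: "inj_on nxt C"
  using movers_permuted finite_subset[OF movers_side finite_agents]
  by (intro eq_card_imp_inj_on) auto

lemma inj_on_s: "inj_on s C"
  using inj_on_nxt by (auto simp: inj_on_def)

lemma nxt_mover: "x \<in> C \<Longrightarrow> nxt x \<in> C"
  using movers_permuted by blast

lemma s_opposite: "x \<in> C \<Longrightarrow> s x \<in> agents I (opposite X)"
  using succ_agent_opposite[OF F_subset M_subset] movers_side movers_candidates by blast

lemmas s_candidate = succ_agent_candidate[OF F_subset M_subset movers_candidates]

lemma nxt_mate: "x \<in> C \<Longrightarrow> nxt x \<in> mates M (s x)"
  using least_at_next_agent[OF F_subset M_subset movers_candidates] by (simp add: least_at_def)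

lemma rotated_subset: "rotated \<subseteq> F"
  using M_subset s_candidate(1) by (auto simp: rotated_def mem_mates_iff)

lemma rotated_edges: "rotated \<subseteq> edges I"
  using rotated_subset F_subset by blast

lemma mem_mates_rotated:
  assumes "x \<in> agents I X"
  shows "y \<in> mates rotated x \<longleftrightarrow>
    y \<in> mates M x \<and> \<not> (\<exists>u \<in> C. x = nxt u \<and> y = s u) \<or> x \<in> C \<and> y = s x"
proof -
  have "{x, y} = {u, s w} \<longleftrightarrow> x = u \<and> y = s w" if "u \<in> C" "w \<in> C" for u w
    using assms s_opposite[OF that(2)] that(1) movers_side agents_disjoint[of X]
    by (auto simp: doubleton_eq_iff)
  then have "{x, y} \<in> (\<lambda>u. {nxt u, s u}) ` C \<longleftrightarrow> (\<exists>u \<in> C. x = nxt u \<and> y = s u)"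
      "{x, y} \<in> (\<lambda>u. {u, s u}) ` C \<longleftrightarrow> x \<in> C \<and> y = s x"
    using nxt_mover by blast+
  then show ?thesis unfolding rotated_def mem_mates_iff by blast
qed

lemma mates_rotated_other:
  assumes "x \<in> agents I X - C"
  shows "mates rotated x = mates M x"
  using assms nxt_mover mem_mates_rotated[of x] by auto

lemma mates_rotated_mover:
  assumes "x \<in> C"
  shows "mates rotated (nxt x) = insert (s (nxt x)) (mates M (nxt x) - {s x})"
proof -
  have "(\<exists>u \<in> C. nxt x = nxt u \<and> y = s u) \<longleftrightarrow> y = s x" for y
    using inj_onD[OF inj_on_nxt] assms by blast
  then show ?thesis using mem_mates_rotated[of "nxt x"] nxt_mover[OF assms] movers_side by auto
qed

lemma mem_mates_rotated_opposite:
  assumes "y \<in> agents I (opposite X)"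
  shows "x \<in> mates rotated y \<longleftrightarrow>
    x \<in> mates M y \<and> \<not> (\<exists>u \<in> C. x = nxt u \<and> y = s u) \<or> x \<in> C \<and> y = s x"
proof (cases "x \<in> agents I X")
  case True
  then show ?thesis using mem_mates_rotated[of x y] mates_commute[of y _ x] by simp
next
  case False
  then have "x \<notin> mates rotated y" "x \<notin> mates M y" "x \<notin> C"
    using mates_subset_agents[OF assms rotated_edges] mates_subset_agents[OF assms M_edges]
      movers_side by auto
  then show ?thesis by blast
qed

lemma mates_rotated_opposite_other:
  assumes "y \<in> agents I (opposite X) - s ` C"
  shows "mates rotated y = mates M y"
  using assms mem_mates_rotated_opposite[of y] by auto

lemma mates_rotated_opposite_mover:
  assumes "x \<in> C"
  shows "mates rotated (s x) = insert x (mates M (s x) - {nxt x})"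
proof -
  have "(\<exists>u \<in> C. v = nxt u \<and> s x = s u) \<longleftrightarrow> v = nxt x" "v \<in> C \<and> s x = s v \<longleftrightarrow> v = x" for v
    using inj_onD[OF inj_on_s] assms by blast+
  then show ?thesis using mem_mates_rotated_opposite[OF s_opposite[OF assms]] by auto
qed

lemma card_mates_rotated:
  assumes "v \<in> vertices"
  shows "card (mates rotated v) = card (mates M v)"
proof -
  have exchange: "card (insert p (mates M v - {q})) = card (mates M v)"
    if "p \<notin> mates M v" "q \<in> mates M v" for p q
    using that finite_mates[OF M_edges, of v] card_Suc_Diff1[OF _ that(2)] by simp
  consider (bystander) "v \<in> agents I X - C"
    | (mover) "v \<in> C"
    | (opposite_bystander) "v \<in> agents I (opposite X) - s ` C"
    | (opposite_mover) "v \<in> s ` C"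
    using assms vertices_eq_agents[of X] by blast
  then show ?thesis
  proof cases
    case mover
    then obtain x where x: "x \<in> C" "v = nxt x" using movers_permuted by blast
    have "s x \<in> mates M v" using nxt_mate[OF x(1)] x(2) mates_commute by metis
    then show ?thesis
      using exchange s_candidate(2)[OF mover] mates_rotated_mover[OF x(1)] x(2) by simp
  next
    case opposite_mover
    then obtain x where x: "x \<in> C" "v = s x" by blast
    have "x \<notin> mates M v" using s_candidate(2)[OF x(1)] x(2) mates_commute by metis
    then show ?thesis
      using exchange nxt_mate[OF x(1)] mates_rotated_opposite_mover[OF x(1)] x(2) by simp
  qed (use mates_rotated_other mates_rotated_opposite_other in auto)
qed

lemma assignment_rotated: "assignment I M \<Longrightarrow> assignment I rotated"
  using rotated_edges card_mates_rotated by (simp add: assignment_iff)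

end

context two_sided_market
begin

lemma rotation_list_zipD:
  assumes "rotation_list F X M \<rho>" "z \<in> set (zip \<rho> (rotate1 \<rho>))"
  shows "candidates F M (snd (fst z)) \<noteq> {}" "succ_agent F M (snd (fst z)) = fst (snd z)"
    "next_agent F M (snd (fst z)) = snd (snd z)" "full M (fst (snd z))"
proof -
  have "snd z \<in> set \<rho>" using assms(2) set_zip_rightD[of "fst z" "snd z" \<rho> "rotate1 \<rho>"] by simp
  then show "candidates F M (snd (fst z)) \<noteq> {}" "succ_agent F M (snd (fst z)) = fst (snd z)"
      "next_agent F M (snd (fst z)) = snd (snd z)" "full M (fst (snd z))"
    using assms by (auto simp: rotation_list_def case_prod_unfold)
qed

lemma rotation_list_imp_rotation:
  assumes F: "F \<subseteq> edges I" and M: "M \<subseteq> F" and \<rho>: "rotation_list F X M \<rho>"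
  shows "rotation I F X M (snd ` set \<rho>)"
proof (unfold_locales; (rule F M)?)
  show "snd ` set \<rho> \<subseteq> agents I X" "snd ` set \<rho> \<noteq> {}"
    using \<rho> by (auto simp: rotation_list_def)
  have "next_agent F M ` snd ` set \<rho> = (\<lambda>z. snd (snd z)) ` set (zip \<rho> (rotate1 \<rho>))"
    unfolding image_fst_zip_rotate1[of _ \<rho>] image_image
    using rotation_list_zipD(3)[OF \<rho>] by (intro image_cong) auto
  then show "next_agent F M ` snd ` set \<rho> = snd ` set \<rho>"
    by (simp only: image_snd_zip_rotate1[of _ \<rho>])
  fix x assume "x \<in> snd ` set \<rho>"
  then obtain z where "x = snd (fst z)" "z \<in> set (zip \<rho> (rotate1 \<rho>))"
    unfolding image_fst_zip_rotate1[of _ \<rho>] by blast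
  then show "candidates F M x \<noteq> {}" "full M (succ_agent F M x)"
    using rotation_list_zipD[OF \<rho>] by auto
qed

lemma eliminate_eq_rotated:
  assumes F: "F \<subseteq> edges I" and M: "M \<subseteq> F" and \<rho>: "rotation_list F X M \<rho>"
  shows "eliminate M \<rho> = rotation.rotated I F M (snd ` set \<rho>)"
proof -
  let ?Z = "set (zip \<rho> (rotate1 \<rho>))" and ?C = "snd ` set \<rho>"
  have "{{snd (\<rho> ! i), fst (\<rho> ! i)} |i. i < length \<rho>} = (\<lambda>q. {snd q, fst q}) ` set \<rho>"
    by (auto simp: set_conv_nth)
  also have "\<dots> = (\<lambda>z. {snd (snd z), fst (snd z)}) ` ?Z" by (rule image_snd_zip_rotate1)
  also have "\<dots> = (\<lambda>x. {next_agent F M x, succ_agent F M x}) ` ?C"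
    unfolding image_fst_zip_rotate1[of _ \<rho>] image_image
    using rotation_list_zipD(2,3)[OF \<rho>] by (intro image_cong) auto
  finally have removed: "{{snd (\<rho> ! i), fst (\<rho> ! i)} |i. i < length \<rho>} =
      (\<lambda>x. {next_agent F M x, succ_agent F M x}) ` ?C" .
  have "{{snd (\<rho> ! i), fst (\<rho> ! (Suc i mod length \<rho>))} |i. i < length \<rho>} =
      (\<lambda>z. {snd (fst z), fst (snd z)}) ` ?Z"
    by (auto simp: zip_rotate1_conv_nth image_image)
  also have "\<dots> = (\<lambda>x. {x, succ_agent F M x}) ` ?C"
    unfolding image_fst_zip_rotate1[of _ \<rho>] image_image
    using rotation_list_zipD(2)[OF \<rho>] by (intro image_cong) auto
  finally have added: "{{snd (\<rho> ! i), fst (\<rho> ! (Suc i mod length \<rho>))} |i. i < length \<rho>} =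
      (\<lambda>x. {x, succ_agent F M x}) ` ?C" .
  show ?thesis
    unfolding eliminate_def removed added
      rotation.rotated_def[OF rotation_list_imp_rotation[OF assms]] ..
qed

text \<open>An edge \<open>xy\<close> at which \<open>y\<close> has a free seat may still block \<open>M\<close>. The arcs of the rotation
  digraph ignore such edges, so this is all that survives in the current graph of the algorithm.\<close>

definition weakly_stable :: "side \<Rightarrow> 'v set set \<Rightarrow> 'v set set \<Rightarrow> bool" where
  "weakly_stable X F M \<longleftrightarrow> (\<forall>x \<in> agents I X. \<forall>y \<in> candidates F M x. \<not> admits M x y)"

definition compatibly_covered :: "'v set set \<Rightarrow> 'v set set \<Rightarrow> bool" where
  "compatibly_covered K M \<longleftrightarrow> (\<forall>e \<in> K. \<exists>N. e \<in> N \<and> N \<subseteq> K \<and> compatible M N)"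

definition rank_at :: "'v \<Rightarrow> 'v \<Rightarrow> nat" where
  "rank_at v w = card {z. z \<prec>\<^bsub>v\<^esub> w}"

definition potential :: "side \<Rightarrow> 'v set set \<Rightarrow> nat" where
  "potential X M = (\<Sum>x\<in>agents I X. \<Sum>y\<in>mates M x. rank_at x y)"

lemma weakly_stable_mono: "weakly_stable X F M \<Longrightarrow> F' \<subseteq> F \<Longrightarrow> weakly_stable X F' M"
  using candidates_mono unfolding weakly_stable_def by blast

lemma unblocked_imp_weakly_stable:
  assumes "unblocked F M"
  shows "weakly_stable X F M"
  unfolding weakly_stable_def
proof (intro ballI)
  fix x y assume y: "y \<in> candidates F M x"
  then have "admits M y x" by (auto simp: candidates_def admits_def)
  then show "\<not> admits M x y" using unblockedD[OF assms, of y x] y by (auto simp: candidates_def)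
qed

lemma rank_at_strict_mono:
  assumes "v \<in> vertices" "w \<prec>\<^bsub>v\<^esub> w'"
  shows "rank_at v w < rank_at v w'"
  unfolding rank_at_def
proof (rule psubset_card_mono)
  show "finite {z. z \<prec>\<^bsub>v\<^esub> w'}"
    by (rule finite_subset[OF _ finite_mates[OF order_refl, of v]])
      (use pref_subset[OF assms(1)] in auto)
  show "{z. z \<prec>\<^bsub>v\<^esub> w} \<subset> {z. z \<prec>\<^bsub>v\<^esub> w'}"
    using assms less_pref_trans[OF assms(1)] less_pref_irrefl[OF assms(1)] by blast
qed

lemma removable_not_covered:
  assumes F: "F \<subseteq> edges I" and M: "M \<subseteq> F" and K: "K \<subseteq> F" "compatibly_covered K M"
    and removable: "removable F M x"
  shows "{x, succ_agent F M x} \<notin> K"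
proof
  let ?y = "succ_agent F M x"
  have cand: "candidates F M x \<noteq> {}" using removable by (simp add: removable_def)
  assume "{x, ?y} \<in> K"
  then obtain N where N: "{x, ?y} \<in> N" "N \<subseteq> K" "compatible M N"
    using K(2) unfolding compatibly_covered_def by meson
  have x: "x \<in> mates N ?y - mates M ?y"
    using N(1) succ_agent_candidate(2)[OF F M cand] by (auto simp: mem_mates_iff insert_commute)
  then have "full M ?y" using compatible_mates_full(1)[OF N(3)] by (auto simp: full_def)
  then have "candidates F M (next_agent F M x) = {}" using removable by (simp add: removable_def)
  then have "candidates N M (next_agent F M x) = {}"
    using candidates_mono[OF order_trans[OF N(2) K(1)]] by blast
  moreover have "favours M N (next_agent F M x)"
    using favours_if_replaced[OF N(3) least_at_next_agent[OF F M cand] x]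
      next_agent_less_pref[OF F M cand] by blast
  ultimately show False using candidates_compatible_eq_empty_iff[OF N(3)] by blast
qed

end

context rotation
begin

lemmas s_greatest = greatest_at_succ_agent[OF F_subset M_subset movers_candidates]

lemma weakly_stable_rotated:
  assumes "weakly_stable X F M"
  shows "weakly_stable X F rotated"
  unfolding weakly_stable_def
proof (intro ballI notI)
  fix x y
  assume x: "x \<in> agents I X" and y: "y \<in> candidates F rotated x" and admits: "admits rotated x y"
  have y_new: "y \<in> mates F x" "y \<notin> mates rotated x" using y by (auto simp: candidates_def)
  have y_side: "y \<in> agents I (opposite X)"
    using mates_subset_agents[OF x F_subset] y_new(1) by blast
  have vertices: "x \<in> vertices" "y \<in> vertices" using x y_side agents_subset_vertices by blast+
  obtain w where w: "w \<in> mates rotated y" "w \<prec>\<^bsub>y\<^esub> x" using y by (auto simp: candidates_def)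
  have "\<exists>w' \<in> mates M y. w' \<prec>\<^bsub>y\<^esub> x"
  proof (cases "w \<in> mates M y")
    case False
    then have "w \<in> C" "y = s w" using w(1) mem_mates_rotated_opposite[OF y_side] by auto
    then show ?thesis
      using nxt_mate next_agent_less_pref[OF F_subset M_subset movers_candidates]
        less_pref_trans[OF vertices(2) _ w(2)] by blast
  qed (use w(2) in blast)
  then obtain w' where w': "w' \<in> mates M y" "w' \<prec>\<^bsub>y\<^esub> x" by blast
  have "y \<notin> mates M x"
  proof
    assume "y \<in> mates M x"
    then obtain u where "u \<in> C" "x = nxt u" "y = s u"
      using y_new(2) mem_mates_rotated[OF x] by blast
    then have "w' = x \<or> x \<prec>\<^bsub>y\<^esub> w'"
      using least_at_next_agent[OF F_subset M_subset movers_candidates] w'(1)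
      by (auto simp: least_at_def)
    then show False
      using w'(2) less_pref_asym[OF vertices(2)] less_pref_irrefl[OF vertices(2)] by blast
  qed
  then have cand: "y \<in> candidates F M x" using y_new w' by (auto simp: candidates_def)
  then have not_admits: "\<not> admits M x y" using assms x by (auto simp: weakly_stable_def)
  then obtain u where u: "u \<in> mates rotated x" "u \<prec>\<^bsub>x\<^esub> y"
    using admits card_mates_rotated[OF vertices(1)] by (auto simp: admits_def)
  then have "x \<in> C" "u = s x" using not_admits mem_mates_rotated[OF x] by (auto simp: admits_def)
  then have "y = u \<or> y \<prec>\<^bsub>x\<^esub> u" using s_greatest cand by (auto simp: greatest_at_def)
  then show False
    using u(2) less_pref_asym[OF vertices(1)] less_pref_irrefl[OF vertices(1)] by blast
qed

lemma unblocked_rotated: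
  assumes "weakly_stable X F M" and K: "K \<subseteq> F" "compatibly_covered K M"
  shows "unblocked K rotated"
proof (rule unblockedI_side)
  show "K \<subseteq> edges I" using K(1) F_subset by blast
  fix x y assume x: "x \<in> agents I X" and y: "y \<in> mates K x - mates rotated x"
  show "\<not> (admits rotated x y \<and> admits rotated y x)"
  proof
    assume admits: "admits rotated x y \<and> admits rotated y x"
    have y_mate: "y \<in> mates F x" using y mates_mono[OF K(1)] by blast
    have y_side: "y \<in> agents I (opposite X)"
      using mates_subset_agents[OF x F_subset] y_mate by blast
    then have "y \<in> vertices" using agents_subset_vertices by blast
    moreover have "y \<notin> candidates F rotated x"
      using weakly_stable_rotated[OF assms(1)] x admits by (auto simp: weakly_stable_def)
    ultimately have unfilled: "card (mates M y) < quota I y"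
      using admits y y_mate card_mates_rotated by (auto simp: candidates_def admits_def)
    then have "y \<notin> s ` C" using movers_full by (auto simp: full_def)
    then have "mates rotated y = mates M y" using mates_rotated_opposite_other y_side by blast
    then have "x \<notin> mates M y" using y mates_commute by (metis DiffD2)
    moreover have "{x, y} \<in> K" using y by (simp add: mem_mates_iff)
    then obtain N where N: "{x, y} \<in> N" "compatible M N"
      using K(2) by (auto simp: compatibly_covered_def)
    then have "mates M y = mates N y" using compatible_mates_full(1)[OF N(2)] unfilled by fastforce
    ultimately show False using N(1) by (simp add: mem_mates_iff insert_commute)
  qed
qed

lemma potential_rotated:
  assumes M: "assignment I M" and stable: "weakly_stable X F M"
  shows "potential X rotated < potential X M"
  unfolding potential_def
proof (rule sum_strict_mono_ex1[OF finite_agents])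
  have less: "(\<Sum>y\<in>mates rotated x. rank_at x y) < (\<Sum>y\<in>mates M x. rank_at x y)" if x: "x \<in> C" for x
  proof -
    obtain u where u: "u \<in> C" "x = nxt u" using x movers_permuted by blast
    have x_side: "x \<in> agents I X" using x movers_side by blast
    then have x_vertex: "x \<in> vertices" using agents_subset_vertices by blast
    have "s x \<in> candidates F M x" using s_greatest[OF x] by (simp add: greatest_at_def)
    then have "\<not> admits M x (s x)" using stable x_side by (auto simp: weakly_stable_def)
    moreover have "s x \<in> mates (edges I) x"
      using s_candidate(1)[OF x] mates_mono[OF F_subset] by blast
    moreover have s_u_mate: "s u \<in> mates M x" using nxt_mate[OF u(1)] u(2) mates_commute by metis
    ultimately have "s x \<prec>\<^bsub>x\<^esub> s u"
      using not_admitsD(2)[OF M x_vertex] s_candidate(2)[OF x] by metis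
    then have rank: "rank_at x (s x) < rank_at x (s u)" by (rule rank_at_strict_mono[OF x_vertex])
    have fin: "finite (mates M x)" by (rule finite_mates[OF M_edges])
    have "(\<Sum>y\<in>mates rotated x. rank_at x y) = rank_at x (s x) + (\<Sum>y\<in>mates M x - {s u}. rank_at x y)"
      using mates_rotated_mover[OF u(1)] u(2) s_candidate(2)[OF x] fin by simp
    also have "\<dots> < rank_at x (s u) + (\<Sum>y\<in>mates M x - {s u}. rank_at x y)"
      using rank by simp
    also have "\<dots> = (\<Sum>y\<in>mates M x. rank_at x y)"
      by (rule sum.remove[OF fin s_u_mate, symmetric])
    finally show ?thesis .
  qed
  show "\<forall>x\<in>agents I X. (\<Sum>y\<in>mates rotated x. rank_at x y) \<le> (\<Sum>y\<in>mates M x. rank_at x y)"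
    using less mates_rotated_other by (metis DiffI less_imp_le order_refl)
  show "\<exists>x\<in>agents I X. (\<Sum>y\<in>mates rotated x. rank_at x y) < (\<Sum>y\<in>mates M x. rank_at x y)"
    using less movers_nonempty movers_side by blast
qed

lemma rotated_not_overtaking:
  assumes N: "compatible N M" "compatible N rotated" "N \<subseteq> F"
    and x: "x \<in> agents I X" and favours: "favours M N x"
  shows "\<not> favours N rotated x"
proof
  assume overtaken: "favours N rotated x"
  then obtain w where w: "w \<in> mates rotated x - mates N x" by (auto simp: favours_def)
  obtain y where y: "y \<in> mates N x - mates M x" using favours by (auto simp: favours_def)
  have compat: "compatible M N" using N(1) by (rule compatible_sym)
  have "w \<prec>\<^bsub>x\<^esub> y" using favours_less_pref[OF N(2) overtaken w] y by blast
  moreover have "y = w \<or> y \<prec>\<^bsub>x\<^esub> w"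
  proof (cases "w \<in> mates M x")
    case True
    then show ?thesis using favours_less_pref[OF compat favours y] by blast
  next
    case False
    then have "x \<in> C" "w = s x" using w mem_mates_rotated[OF x] by auto
    moreover have "y \<in> candidates N M x"
      using y favours by (simp add: candidates_compatible[OF compat])
    then have "y \<in> candidates F M x" using candidates_mono[OF N(3)] by blast
    ultimately show ?thesis using s_greatest by (auto simp: greatest_at_def)
  qed
  moreover have "x \<in> vertices" using x agents_subset_vertices by blast
  ultimately show False using less_pref_asym less_pref_irrefl by blast
qed

end

section \<open>Fixed points of the covering map\<close>

context two_sided_market
begin

definition unblocked_by :: "'v set set \<Rightarrow> 'v set set set" where
  "unblocked_by F = {M. assignment I M \<and> unblocked F M}"

definition covered :: "'v set set \<Rightarrow> 'v set set" where
  "covered F = \<Union>(unblocked_by F)"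

lemma covered_antimono: "F \<subseteq> F' \<Longrightarrow> covered F' \<subseteq> covered F"
  using unblocked_mono unfolding covered_def unblocked_by_def by blast

lemma covered_edges: "covered F \<subseteq> edges I"
  using assignment_edges unfolding covered_def unblocked_by_def by blast

lemma unblocked_by_subset_covered: "M \<in> unblocked_by F \<Longrightarrow> M \<subseteq> covered F"
  unfolding covered_def by blast

lemma unblocked_by_compatible:
  assumes "M \<in> unblocked_by (covered P)" "M \<subseteq> P" "N \<in> unblocked_by P"
  shows "compatible M N"
  using assms unblocked_by_subset_covered[OF assms(3)] unblocked_mono
  unfolding compatible_def unblocked_by_def by blast

lemma compatibly_covered_covered:
  assumes "M \<in> unblocked_by (covered P)" "M \<subseteq> P"
  shows "compatibly_covered (covered P) M"
  using unblocked_by_compatible[OF assms] unblocked_by_subset_covered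
  unfolding compatibly_covered_def covered_def by blast

lemma ex_potential_decreasing_rotation:
  assumes Q: "Q \<subseteq> edges I" and N: "N \<in> unblocked_by Q" "N \<subseteq> Q" "compatibly_covered Q N"
    and x: "x \<in> agents I X" "candidates Q N x \<noteq> {}"
  shows "\<exists>C. rotation I Q X N C \<and> rotation.rotated I Q N C \<in> unblocked_by Q \<and>
    potential X (rotation.rotated I Q N C) < potential X N"
proof -
  have N': "assignment I N" "weakly_stable X Q N"
    using N(1) unblocked_imp_weakly_stable by (auto simp: unblocked_by_def)
  have "\<not> removable Q N x" for x
    using removable_not_covered[OF Q N(2) order_refl N(3)] succ_agent_candidate(1)[OF Q N(2)]
    by (auto simp: removable_def mem_mates_iff)
  then obtain \<rho> where "rotation_list Q X N \<rho>" using ex_rotation_list[OF Q N(2) x] by blast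
  then interpret rotation I Q X N "snd ` set \<rho>" by (rule rotation_list_imp_rotation[OF Q N(2)])
  have "rotated \<in> unblocked_by Q"
    using assignment_rotated[OF N'(1)] unblocked_rotated[OF N'(2) order_refl N(3)]
    by (simp add: unblocked_by_def)
  then show ?thesis using potential_rotated[OF N'] rotation_axioms by blast
qed

end

locale covering_pair = two_sided_market I for I :: "'v sa_instance" +
  fixes lower upper :: "'v set set"
  assumes upper_eq: "upper = covered lower" and lower_eq: "lower = covered upper"
    and lower_subset_upper: "lower \<subseteq> upper"
begin

lemma upper_edges: "upper \<subseteq> edges I"
  using upper_eq covered_edges by simp

lemma unblocked_by_upper_subset: "N \<in> unblocked_by upper \<Longrightarrow> N \<subseteq> lower"
  using lower_eq unblocked_by_subset_covered by simp

lemma unblocked_by_lower_subset: "M \<in> unblocked_by lower \<Longrightarrow> M \<subseteq> upper"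
  using upper_eq unblocked_by_subset_covered by simp

lemma unblocked_by_upper_lower_compatible:
  "N \<in> unblocked_by upper \<Longrightarrow> M \<in> unblocked_by lower \<Longrightarrow> compatible N M"
  using unblocked_by_compatible[of N lower M] unblocked_by_upper_subset upper_eq by simp

lemma ex_decreasing_rotation:
  assumes "N \<in> unblocked_by upper" "x \<in> agents I X" "candidates upper N x \<noteq> {}"
  shows "\<exists>C. rotation I upper X N C \<and> rotation.rotated I upper N C \<in> unblocked_by upper \<and>
    potential X (rotation.rotated I upper N C) < potential X N"
  using ex_potential_decreasing_rotation[OF upper_edges assms(1) _ _ assms(2,3)] lower_subset_upper
    unblocked_by_upper_subset[OF assms(1)] compatibly_covered_covered[of N lower] assms(1) upper_eq
  by blast

lemma ex_favoured_unblocked_by_upper: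
  assumes M: "M \<in> unblocked_by lower"
  shows "\<exists>N \<in> unblocked_by upper. \<forall>x \<in> agents I X. \<not> favours M N x"
proof -
  obtain N0 where "stable_in upper N0" using ex_optimal_stable_in[OF upper_edges] by blast
  then have "N0 \<in> unblocked_by upper" by (simp add: stable_in_def unblocked_by_def)
  then obtain N where N: "N \<in> unblocked_by upper"
      "\<And>N'. N' \<in> unblocked_by upper \<Longrightarrow> potential (opposite X) N \<le> potential (opposite X) N'"
    using ex_has_least_nat[of "\<lambda>N. N \<in> unblocked_by upper" N0 "potential (opposite X)"] by blast
  note compat = unblocked_by_upper_lower_compatible[OF N(1) M]
  have "candidates M N y = {}" if y: "y \<in> agents I (opposite X)" for y
  proof -
    have "candidates upper N y = {}" using ex_decreasing_rotation[OF N(1) y] N(2) by (meson leD)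
    then show ?thesis using candidates_mono[OF unblocked_by_lower_subset[OF M]] by blast
  qed
  then show ?thesis
    using N(1) candidates_compatible_eq_empty_iff[OF compat]
      favours_sides_iff[OF compat, of "opposite X"]
    by auto
qed

text \<open>Start from a member of \<open>unblocked_by upper\<close> that \<open>x\<close> likes at least as much as \<open>M\<close> and
  eliminate rotations. By \<open>rotated_not_overtaking\<close> they cannot jump over the mates of \<open>x\<close> in \<open>M\<close>.\<close>

lemma ex_unblocked_by_upper_same_mates:
  assumes M: "M \<in> unblocked_by lower" and x: "x \<in> agents I X"
  shows "\<exists>N \<in> unblocked_by upper. mates N x = mates M x"
proof -
  obtain N0 where "N0 \<in> unblocked_by upper \<and> \<not> favours M N0 x"
    using ex_favoured_unblocked_by_upper[OF M] x by blast
  then obtain N where N: "N \<in> unblocked_by upper" "\<not> favours M N x"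
      "\<And>N'. N' \<in> unblocked_by upper \<Longrightarrow> \<not> favours M N' x \<Longrightarrow> potential X N \<le> potential X N'"
    using ex_has_least_nat[of "\<lambda>N. N \<in> unblocked_by upper \<and> \<not> favours M N x" N0 "potential X"]
    by blast
  note compat = unblocked_by_upper_lower_compatible[OF N(1) M]
  have "\<not> favours N M x"
  proof
    assume favours: "favours N M x"
    then have "candidates M N x \<noteq> {}" using candidates_compatible_eq_empty_iff[OF compat] by blast
    then have "candidates upper N x \<noteq> {}"
      using candidates_mono[OF unblocked_by_lower_subset[OF M]] by blast
    then obtain C
      where C: "rotation I upper X N C" "rotation.rotated I upper N C \<in> unblocked_by upper"
        "potential X (rotation.rotated I upper N C) < potential X N"
      using ex_decreasing_rotation[OF N(1) x] by blast
    have "\<not> favours M (rotation.rotated I upper N C) x"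
      by (rule rotation.rotated_not_overtaking[OF C(1) compatible_sym[OF compat] _ _ x favours])
        (use unblocked_by_upper_lower_compatible[OF C(2) M] compatible_sym
          unblocked_by_lower_subset[OF M] in auto)
    then show False using N(3)[OF C(2)] C(3) by simp
  qed
  then show ?thesis using N(1,2) compatible_favours_cases[OF compat] by blast
qed

lemma lower_eq_upper: "lower = upper"
proof (rule equalityI[OF lower_subset_upper], rule subsetI)
  fix e assume "e \<in> upper"
  then obtain M where M: "e \<in> M" "M \<in> unblocked_by lower" using upper_eq by (auto simp: covered_def)
  then obtain a b where e: "e = {a, b}" "a \<in> agents I Students"
    using edge_agents[of e Students] unblocked_by_lower_subset upper_edges by blast
  then obtain N where N: "N \<in> unblocked_by upper" "mates N a = mates M a"
    using ex_unblocked_by_upper_same_mates[OF M(2)] by blast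
  then have "e \<in> N" using M(1) e(1) by (metis mem_mates_iff)
  then show "e \<in> lower" using unblocked_by_upper_subset[OF N(1)] by blast
qed

end

context two_sided_market
begin

lemma ex1_covered_fixpoint: "\<exists>!P. covered P = P"
proof -
  define P where "P = lfp (\<lambda>F. covered (covered F))"
  have mono: "mono (\<lambda>F. covered (covered F))" by (simp add: monoI covered_antimono)
  have P: "covered (covered P) = P" using lfp_unfold[OF mono] by (simp add: P_def)
  have least: "P \<subseteq> F" if "covered (covered F) = F" for F
    using lfp_lowerbound[of "\<lambda>F. covered (covered F)" F] that by (simp add: P_def)
  have "P \<subseteq> covered P" using least[of "covered P"] P by simp
  then have "covering_pair I P (covered P)" using P by unfold_locales auto
  then have fixpoint: "covered P = P" using covering_pair.lower_eq_upper by metis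
  moreover have "F = P" if "covered F = F" for F
    using least[of F] covered_antimono[of P F] that fixpoint by auto
  ultimately show ?thesis by blast
qed

end

section \<open>The algorithm\<close>

context two_sided_market
begin

lemma rr_step_iff:
  assumes F: "F \<subseteq> edges I" and M: "M \<subseteq> F"
  shows "rr_step I X (M, F) \<sigma> \<longleftrightarrow>
    (\<exists>x \<in> agents I X. removable F M x \<and> \<sigma> = (M, F - {{x, succ_agent F M x}})) \<or>
    (\<exists>\<rho>. rotation_list F X M \<rho> \<and> \<sigma> = (eliminate M \<rho>, F))"
proof -
  let ?D = "rotation_digraph (restrict_edges I F) X M"
  have "rr_step I X (M, F) \<sigma> \<longleftrightarrow>
      (\<exists>x \<in> agents I X. \<exists>y.
        ((Some x, Some y) \<in> parcs ?D \<and> (\<exists>z. (Some y, z) \<in> parcs ?D \<and> is_sink ?D z)) \<and>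
        \<sigma> = (M, F - {{x, y}})) \<or>
      (\<exists>\<rho>. is_rotation (restrict_edges I F) X M \<rho> \<and> \<sigma> = (eliminate M \<rho>, F))"
    unfolding rr_step.simps rr_digraph_def by auto
  then show ?thesis
    by (simp add: removable_iff[OF F M] is_rotation_iff[OF F M] conj_assoc cong: bex_cong)
qed

definition rr_invariant :: "'v set set \<Rightarrow> side \<Rightarrow> 'v rr_state \<Rightarrow> bool" where
  "rr_invariant P X \<sigma> \<longleftrightarrow> fst \<sigma> \<in> unblocked_by P \<and> P \<subseteq> snd \<sigma> \<and> snd \<sigma> \<subseteq> edges I \<and>
     weakly_stable X (snd \<sigma>) (fst \<sigma>)"

definition rr_measure :: "side \<Rightarrow> 'v rr_state \<Rightarrow> nat" where
  "rr_measure X \<sigma> = card (snd \<sigma>) + potential X (fst \<sigma>)"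

context
  fixes P :: "'v set set"
  assumes fixpoint: "covered P = P"
begin

lemma unblocked_by_fixpoint_subset: "M \<in> unblocked_by P \<Longrightarrow> M \<subseteq> P"
  using unblocked_by_subset_covered[of M P] fixpoint by simp

lemma unblocked_by_fixpoint_compatible:
  "M \<in> unblocked_by P \<Longrightarrow> N \<in> unblocked_by P \<Longrightarrow> compatible M N"
  using unblocked_by_compatible[of M P N] unblocked_by_fixpoint_subset fixpoint by simp

lemma compatibly_covered_fixpoint: "M \<in> unblocked_by P \<Longrightarrow> compatibly_covered P M"
  using compatibly_covered_covered[of M P] unblocked_by_fixpoint_subset fixpoint by simp

lemma rr_invariantD:
  assumes "rr_invariant P X (M, F)"
  shows "M \<in> unblocked_by P" "assignment I M" "P \<subseteq> F" "M \<subseteq> F" "F \<subseteq> edges I" "weakly_stable X F M"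
  using assms unblocked_by_fixpoint_subset[of M] by (auto simp: rr_invariant_def unblocked_by_def)

lemma rr_invariant_remove:
  assumes inv: "rr_invariant P X (M, F)" and removable: "removable F M x"
  defines "F' \<equiv> F - {{x, succ_agent F M x}}"
  shows "rr_invariant P X (M, F') \<and> rr_measure X (M, F') < rr_measure X (M, F)"
proof -
  note M = rr_invariantD(1)[OF inv]
    and P_subset = rr_invariantD(3)[OF inv]
    and M_subset = rr_invariantD(4)[OF inv]
    and F_edges = rr_invariantD(5)[OF inv]
    and stable = rr_invariantD(6)[OF inv]
  have "{x, succ_agent F M x} \<notin> P"
    by (rule removable_not_covered[OF F_edges M_subset P_subset _ removable])
      (rule compatibly_covered_fixpoint[OF M])
  then have "rr_invariant P X (M, F')"
    using M P_subset F_edges weakly_stable_mono[OF stable, of F']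
    by (auto simp: rr_invariant_def F'_def)
  moreover have "{x, succ_agent F M x} \<in> F"
    using removable succ_agent_candidate(1)[OF F_edges M_subset]
    by (simp add: removable_def mem_mates_iff)
  then have "card F' < card F"
    unfolding F'_def by (rule card_Diff1_less[OF finite_subset[OF F_edges finite_edges]])
  ultimately show ?thesis by (simp add: rr_measure_def)
qed

lemma rr_invariant_rotate:
  assumes inv: "rr_invariant P X (M, F)" and \<rho>: "rotation_list F X M \<rho>"
  shows "rr_invariant P X (eliminate M \<rho>, F) \<and>
    rr_measure X (eliminate M \<rho>, F) < rr_measure X (M, F)"
proof -
  note M = rr_invariantD(1)[OF inv]
    and M_assignment = rr_invariantD(2)[OF inv]
    and P_subset = rr_invariantD(3)[OF inv]
    and M_subset = rr_invariantD(4)[OF inv]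
    and F_edges = rr_invariantD(5)[OF inv]
    and stable = rr_invariantD(6)[OF inv]
  interpret rotation I F X M "snd ` set \<rho>"
    by (rule rotation_list_imp_rotation[OF F_edges M_subset \<rho>])
  have eliminate_eq: "eliminate M \<rho> = rotated" by (rule eliminate_eq_rotated[OF F_edges M_subset \<rho>])
  have "rotated \<in> unblocked_by P"
    using assignment_rotated[OF M_assignment]
      unblocked_rotated[OF stable P_subset compatibly_covered_fixpoint[OF M]]
    by (simp add: unblocked_by_def)
  then have "rr_invariant P X (rotated, F)"
    using P_subset F_edges weakly_stable_rotated[OF stable] by (simp add: rr_invariant_def)
  then show ?thesis
    using potential_rotated[OF M_assignment stable] by (simp add: eliminate_eq rr_measure_def)
qed

lemma rr_invariant_step:
  assumes "rr_step I X \<sigma> \<sigma>'" "rr_invariant P X \<sigma>"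
  shows "rr_invariant P X \<sigma>' \<and> rr_measure X \<sigma>' < rr_measure X \<sigma>"
proof -
  obtain M F where \<sigma>: "\<sigma> = (M, F)" by (cases \<sigma>)
  note M_subset = rr_invariantD(4)[OF assms(2)[unfolded \<sigma>]]
    and F_edges = rr_invariantD(5)[OF assms(2)[unfolded \<sigma>]]
  show ?thesis
    using assms rr_step_iff[OF F_edges M_subset] rr_invariant_remove rr_invariant_rotate
    by (auto simp: \<sigma>)
qed

lemma rr_invariant_reachable:
  assumes "rr_reachable I X \<sigma>" "rr_invariant P X (rr_init I X)"
  shows "rr_invariant P X \<sigma>"
  using assms(1) unfolding rr_reachable_def
proof (induction rule: rtranclp_induct)
  case (step \<sigma> \<sigma>')
  then show ?case using rr_invariant_step[OF step(2)] by blast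
qed (rule assms(2))

lemma ex_rr_step:
  assumes inv: "rr_invariant P X \<sigma>" and running: "\<not> rr_halted I X \<sigma>"
  shows "\<exists>\<sigma>'. rr_step I X \<sigma> \<sigma>'"
proof -
  obtain M F where \<sigma>: "\<sigma> = (M, F)" by (cases \<sigma>)
  note M_subset = rr_invariantD(4)[OF inv[unfolded \<sigma>]]
    and F_edges = rr_invariantD(5)[OF inv[unfolded \<sigma>]]
  obtain x where x: "x \<in> agents I X" "candidates F M x \<noteq> {}"
    using running no_arcs_iff[OF F_edges M_subset] by (auto simp: \<sigma> rr_halted_def rr_digraph_def)
  show ?thesis
  proof (cases "\<exists>x \<in> agents I X. removable F M x")
    case False
    then obtain \<rho> where "rotation_list F X M \<rho>"
      using ex_rotation_list[OF F_edges M_subset x] by blast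
    then show ?thesis unfolding \<sigma> rr_step_iff[OF F_edges M_subset] by blast
  qed (auto simp: \<sigma> rr_step_iff[OF F_edges M_subset])
qed

lemma rr_halted_optimal:
  assumes inv: "rr_invariant P X (M, F)" and halted: "rr_halted I X (M, F)"
    and N: "N \<in> unblocked_by P" and x: "x \<in> agents I X"
  shows "\<not> favours M N x"
proof -
  note M = rr_invariantD(1)[OF inv]
    and P_subset = rr_invariantD(3)[OF inv]
    and M_subset = rr_invariantD(4)[OF inv]
    and F_edges = rr_invariantD(5)[OF inv]
  have "candidates F M x = {}"
    using halted x no_arcs_iff[OF F_edges M_subset] by (simp add: rr_halted_def rr_digraph_def)
  moreover have "N \<subseteq> F" using unblocked_by_fixpoint_subset[OF N] P_subset by blast
  ultimately have "candidates N M x = {}" using candidates_mono by blast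
  then show ?thesis
    using candidates_compatible_eq_empty_iff[OF unblocked_by_fixpoint_compatible[OF M N]] by simp
qed

lemma rr_terminates_if_invariant:
  assumes init: "rr_invariant P X (rr_init I X)"
  shows "rr_terminates I X"
proof -
  let ?R = "{(\<sigma>', \<sigma>). rr_invariant P X \<sigma> \<and> rr_step I X \<sigma> \<sigma>'}"
  have "?R \<subseteq> measure (rr_measure X)" using rr_invariant_step by auto
  then have "wf ?R" by (rule wf_subset[OF wf_measure])
  then have no_chain: "\<nexists>S. \<forall>i. (S (Suc i), S i) \<in> ?R"
    by (rule iffD1[OF wf_iff_no_infinite_down_chain])
  have "\<nexists>S. S 0 = rr_init I X \<and> (\<forall>i. rr_step I X (S i) (S (Suc i)))"
  proof
    assume "\<exists>S. S 0 = rr_init I X \<and> (\<forall>i. rr_step I X (S i) (S (Suc i)))"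
    then obtain S where S: "S 0 = rr_init I X" "\<And>i. rr_step I X (S i) (S (Suc i))" by blast
    have "rr_invariant P X (S i)" for i
    proof (induction i)
      case (Suc i)
      then show ?case using rr_invariant_step[OF S(2)] by blast
    qed (use S(1) init in simp)
    then show False using no_chain S(2) by blast
  qed
  moreover have "\<exists>\<sigma>'. rr_step I X \<sigma> \<sigma>'" if "rr_reachable I X \<sigma>" "\<not> rr_halted I X \<sigma>" for \<sigma>
    using ex_rr_step rr_invariant_reachable[OF _ init] that by blast
  ultimately show ?thesis unfolding rr_terminates_def by blast
qed

lemma rr_outputs_optimal:
  assumes "rr_outputs I X M" "rr_invariant P X (rr_init I X)"
  shows "M \<in> unblocked_by P \<and> (\<forall>N \<in> unblocked_by P. \<forall>x \<in> agents I X. \<not> favours M N x)"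
proof -
  obtain F where "rr_reachable I X (M, F)" and halted: "rr_halted I X (M, F)"
    using assms(1) by (auto simp: rr_outputs_def)
  then have inv: "rr_invariant P X (M, F)" using rr_invariant_reachable assms(2) by blast
  show ?thesis using rr_invariantD(1)[OF inv] rr_halted_optimal[OF inv halted] by blast
qed

end

end

section \<open>Legal assignments\<close>

locale stable_assignment_market = two_sided_market I for I :: "'v sa_instance" +
  assumes quota_student: "a \<in> students I \<Longrightarrow> quota I a = 1"
begin

lemma mates_student_cases:
  assumes "assignment I M" "a \<in> students I"
  obtains (unassigned) "mates M a = {}" | (assigned) b where "mates M a = {b}"
proof -
  have "card (mates M a) \<le> 1"
    using assignment_card[OF assms(1), of a] assms(2) by (simp add: quota_student)
  then consider (zero) "card (mates M a) = 0" | (one) "card (mates M a) = 1" by linarith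
  then show ?thesis
  proof cases
    case zero
    then show ?thesis using unassigned assignment_finite_mates[OF assms(1)] by simp
  next
    case one
    then show ?thesis using assigned by (auto simp: card_1_singleton_iff)
  qed
qed

lemma prefers_partner_iff:
  assumes M: "assignment I M" and a: "a \<in> students I" and ab: "{a, b} \<in> edges I"
  shows "prefers I a (Some b) (partner M a) \<longleftrightarrow> b \<notin> mates M a \<and> admits M a b"
  using M a
proof (cases rule: mates_student_cases)
  case unassigned
  then show ?thesis using a ab by (simp add: partner_def admits_def quota_student mem_mates_iff)
next
  case (assigned c)
  then show ?thesis
    using a less_pref_irrefl[of a] by (auto simp: partner_def admits_def quota_student)
qed

lemma edge_blocks_iff:
  assumes "assignment I M"
  shows "edge_blocks I a b M \<longleftrightarrow> a \<in> students I \<and> b \<in> schools I \<and> {a, b} \<in> edges I - M \<and>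
    admits M a b \<and> admits M b a"
  using prefers_partner_iff[OF assms, of a b]
  by (auto simp: edge_blocks_def admits_def[of M b] mem_mates_iff)

lemma blocks_iff:
  assumes M: "assignment I M" and K: "K \<subseteq> edges I"
  shows "blocks I K M \<longleftrightarrow> \<not> unblocked K M"
proof
  show "blocks I K M \<Longrightarrow> \<not> unblocked K M"
    using K unfolding blocks_def unblocked_def by (auto simp: edge_blocks_iff[OF M])
next
  assume "\<not> unblocked K M"
  then obtain a b where ab: "a \<in> agents I Students" "b \<in> mates K a - mates M a"
      "admits M a b" "admits M b a"
    using unblockedI_side[OF K, of Students M] by blast
  then have "b \<in> schools I" "{a, b} \<in> K - M"
    using mates_subset_agents[OF ab(1) K] by (auto simp: mem_mates_iff)
  then show "blocks I K M"
    using ab K by (auto simp: blocks_def edge_blocks_iff[OF M])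
qed

lemma stable_iff: "stable I M \<longleftrightarrow> stable_in (edges I) M"
proof -
  have "(\<exists>a b. edge_blocks I a b M) \<longleftrightarrow> blocks I (edges I) M"
    by (auto simp: blocks_def edge_blocks_def)
  then show ?thesis
    unfolding stable_def stable_in_def using blocks_iff assignment_edges by auto
qed

lemma legal_property_iff: "legal_property I L \<longleftrightarrow> L = unblocked_by (\<Union>L)"
proof (cases "L \<subseteq> {M. assignment I M}")
  case True
  have "(\<exists>N \<in> L. blocks I N M) \<longleftrightarrow> \<not> unblocked (\<Union>L) M" if "assignment I M" for M
  proof -
    have "blocks I N M \<longleftrightarrow> \<not> unblocked N M" if "N \<in> L" for N
      using that True blocks_iff[OF \<open>assignment I M\<close>] assignment_edges by blast
    then show ?thesis by (auto simp: unblocked_def)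
  qed
  then have "{M. assignment I M \<and> (\<exists>N \<in> L. blocks I N M)} =
      {M. assignment I M} - unblocked_by (\<Union>L)"
    by (auto simp: unblocked_by_def)
  then have "legal_property I L \<longleftrightarrow>
      {M. assignment I M} - unblocked_by (\<Union>L) = {M. assignment I M} - L"
    using True by (simp add: legal_property_def)
  also have "\<dots> \<longleftrightarrow> L = unblocked_by (\<Union>L)"
    using double_diff[OF True order_refl] double_diff[of "unblocked_by (\<Union>L)", OF _ order_refl]
    by (auto simp: unblocked_by_def)
  finally show ?thesis .
qed (auto simp: legal_property_def unblocked_by_def)

lemma ex_covered_fixpoint_legal_assignments:
  "\<exists>P. covered P = P \<and> legal_assignments I = unblocked_by P"
proof -
  obtain P where P: "covered P = P" "\<And>F. covered F = F \<Longrightarrow> F = P"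
    using ex1_covered_fixpoint by (rule ex1E) metis
  have "legal_property I (unblocked_by P)"
    using P(1) by (simp add: legal_property_iff covered_def)
  moreover have "L = unblocked_by P" if "legal_property I L" for L
  proof -
    have L: "L = unblocked_by (\<Union>L)" using that by (simp only: legal_property_iff)
    then have "covered (\<Union>L) = \<Union>L" unfolding covered_def by simp
    then show ?thesis using L P(2) by simp
  qed
  ultimately have "legal_assignments I = unblocked_by P"
    unfolding legal_assignments_def by (rule the_equality)
  then show ?thesis using P(1) by blast
qed

lemma dominates_iff:
  assumes compat: "compatible M N"
  shows "dominates I M N \<longleftrightarrow> (\<forall>a \<in> students I. \<not> favours N M a)"
proof -
  have "prefers_eq I a (partner M a) (partner N a) \<longleftrightarrow> \<not> favours N M a" if a: "a \<in> students I" for a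
  proof (cases "mates M a = mates N a")
    case True
    then show ?thesis by (simp add: prefers_eq_def partner_def favours_def)
  next
    case False
    then obtain b b' where b: "mates M a = {b}" "mates N a = {b'}"
      using compatible_mates_full[OF compat False] a
      by (auto simp: quota_student card_1_singleton_iff)
    then show ?thesis
      using False a by (auto simp: prefers_eq_def partner_def favours_def admits_def quota_student)
  qed
  then show ?thesis by (simp add: dominates_def)
qed

lemma optimal_in_iff:
  assumes "\<forall>M \<in> S. \<forall>N \<in> S. compatible M N"
  shows "optimal_in I (opposite X) S M \<longleftrightarrow>
    M \<in> S \<and> (\<forall>N \<in> S. \<forall>x \<in> agents I X. \<not> favours M N x)"
proof (cases "M \<in> S")
  case True
  then have compat: "compatible M N" "compatible N M" if "N \<in> S" for N using assms that by blast+
  show ?thesis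
  proof (cases X)
    case Students
    then show ?thesis using True compat dominates_iff by auto
  next
    case Schools
    then show ?thesis
      using True compat dominates_iff favours_sides_iff[OF compat(1), of _ Schools] by auto
  qed
qed (cases X; simp)

lemma stable_optimal_stable: "stable I (optimal_stable I (opposite X))"
proof -
  let ?S = "{M. stable I M}"
  have compatible: "\<forall>M \<in> ?S. \<forall>N \<in> ?S. compatible M N"
    using stable_in_compatible by (simp add: stable_iff)
  note optimal_iff = optimal_in_iff[OF compatible]
  obtain M where M: "stable I M" "\<forall>N. stable I N \<longrightarrow> (\<forall>y \<in> agents I (opposite X). \<not> favours N M y)"
    using ex_optimal_stable_in[of "edges I" "opposite X"] by (auto simp: stable_iff)
  have "\<not> favours M N x" if "stable I N" "x \<in> agents I X" for N x
    using M that compatible favours_sides_iff[of M N X] by auto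
  then have optimal: "optimal_in I (opposite X) ?S M" using M(1) by (simp add: optimal_iff)
  moreover have "N = M" if "optimal_in I (opposite X) ?S N" for N
    using that optimal compatible mates_eq_if_none_favours[of N M X] by (simp add: optimal_iff)
  ultimately have "optimal_stable I (opposite X) = M"
    unfolding optimal_stable_def by (rule the_equality)
  then show ?thesis using M(1) by simp
qed

lemma rr_invariant_init:
  assumes "covered P = P"
  shows "rr_invariant P X (rr_init I X)"
proof -
  let ?M = "optimal_stable I (opposite X)"
  have M: "assignment I ?M" "unblocked (edges I) ?M"
    using stable_optimal_stable by (auto simp: stable_iff stable_in_def)
  have "P \<subseteq> edges I" using covered_edges[of P] assms by simp
  then show ?thesis
    using M unblocked_mono[OF M(2)] unblocked_imp_weakly_stable[OF M(2)]
    by (simp add: rr_invariant_def rr_init_def unblocked_by_def)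
qed

end

lemma stable_assignment_marketI:
  assumes "stable_assignment_instance I"
  shows "stable_assignment_market I"
  using assms unfolding stable_assignment_instance_def by unfold_locales auto

theorem theorem5:
  fixes I :: "'v sa_instance" and X :: side
  assumes "stable_assignment_instance I"
  shows "rr_terminates I X \<and>
    (\<forall>M. rr_outputs I X M \<longrightarrow> optimal_in I (opposite X) (legal_assignments I) M)"
proof -
  interpret stable_assignment_market I using assms by (rule stable_assignment_marketI)
  obtain P where P: "covered P = P" and legal: "legal_assignments I = unblocked_by P"
    using ex_covered_fixpoint_legal_assignments by blast
  have init: "rr_invariant P X (rr_init I X)" by (rule rr_invariant_init[OF P])
  have compatible: "\<forall>M \<in> unblocked_by P. \<forall>N \<in> unblocked_by P. compatible M N"
    using unblocked_by_fixpoint_compatible[OF P] by blast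
  have "optimal_in I (opposite X) (legal_assignments I) M" if "rr_outputs I X M" for M
    using rr_outputs_optimal[OF P that init] unfolding legal optimal_in_iff[OF compatible] .
  then show ?thesis using rr_terminates_if_invariant[OF P init] by blast
qed

end
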